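(* Let $X$, $Y$, $Z$ be simplicial sets and let $u\colon\{1,\dots,k+l+1\}\to\{1,\dots,l+1\}$ be a $1$-biased surjection. Then the two maps $C(X)\otimes C(Y\times Z)\to C(X\times Y)\otimes C(Z)^{\otimes l}$ given by $$\widetilde{AW}_u^{X\times Y,Z}\circ\nabla^{X,Y\times Z}\qquad\text{and}\qquad(\nabla^{X,Y}\otimes1^{\otimes l})\circ(1\otimes\widetilde{AW}_u^{Y,Z})$$ are equal.
   Context: **Conventions.** $\Bbbk$ is a commutative ring with unit; all tensor products are over $\Bbbk$. $C(X)$ is the normalized chain complex of the simplicial set $X$ with coefficients in $\Bbbk$. The Koszul sign rule is used: $(f\otimes g)(a\otimes b)=(-1)^{|g||a|}f(a)\otimes g(b)$, where a map of degree $n$ raises degrees by $n$. Write $[n]=\{0,1,\dots,n\}$. **Shuffle map.** $\nabla^{X,Y}\colon C(X)\otimes C(Y)\to C(X\times Y)$ is given for $x\in X_p$, $y\in Y_q$ by $\nabla(x\otimes y)=\sum\operatorname{sign}(\lambda,\mu)\,(x(\lambda),y(\mu))$, summed over all $(p,q)$-shuffles, i.e. pairs of weakly increasing surjections $\lambda\colon[p+q]\to[p]$, $\mu\colon[p+q]\to[q]$ such that at each step $i-1\to i$ exactly one of $\lambda,\mu$ increases, and it increases by $1$. The sign is that of the permutation moving all steps where $\lambda$ increases before all steps where $\mu$ increases. Here $x(\lambda)$ denotes the simplex obtained from $x$ by pulling back along $\lambda$. **Interval cut operations.** A surjection $u\colon\{1,\dots,k+l\}\to\{1,\dots,l\}$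 is non-degenerate if $u(i)\neq u(i+1)$ for all $1\le i<k+l$; its degree is $|u|=k$. For such $u$ the map $AW_u\colon C(X)\to C(X)^{\otimes l}$ (of degree $k$) is $$AW_u(x)=\sum\pm\,x(\nu_1)\otimes\cdots\otimes x(\nu_l),\qquad x\in X_p,$$ summed over all $0=p_0\le p_1\le\dots\le p_{k+l}=p$, where $\nu_s$ is the concatenation of the intervals $[p_{i-1},p_i]=(p_{i-1},p_{i-1}+1,\dots,p_i)$ with $u(i)=s$ and $x(\nu_s)$ is the corresponding simplex (zero in $C(X)$ if degenerate). The interval $[p_{i-1},p_i]$ is final if $u(j)\ne u(i)$ for all $j>i$, otherwise inner; its length is $p_i-p_{i-1}$ if final and $p_i-p_{i-1}+1$ if inner. The sign is the product of the permutation sign (the Koszul sign, with the lengths as degrees, of the shuffle of intervals reordering $(u(1),\dots,u(k+l))$ to $(1,\dots,1,2,\dots,2,\dots,l,\dots,l)$) and the position sign (the product of $(-1)^{p_i}$ over all inner intervals $[p_{i-1},p_i]$). **$1$-biased.** A non-degenerate surjection $u$ is $1$-biased if no value other than $1$ is assumed more than once (the value $1$ may or may not be repeated). **The map $\widetilde{AW}_u$.** For simplicial sets $X,Y$ and a $1$-biased surjection $u\colon\{1,\dots,k+l+1\}\to\{1,\dots,l+1\}$, $$\widetilde{AW}_u^{X,Y}=\bigl((\pi_X)_*\otimes(\pi_Y)_*^{\otimes l}\bigr)AW_u\colon C(X\times Y)\to C(X)\otimes C(Y)^{\otimes l},$$ where $\pi_X,\pi_Y$ are the projections from $X\times Y$.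 *)

theory Defs
  imports "HOL-Library.Poly_Mapping" "HOL-Combinatorics.Permutations"
begin

section \<open>Simplicial sets\<close>

text \<open>
  A weakly increasing map \<open>\<alpha> : [m] \<rightarrow> [n]\<close> is represented by its list of values
  \<open>[\<alpha> 0, \<dots>, \<alpha> m]\<close>; a map is thus determined by its list and vice versa.  The
  composite of \<open>\<beta> : [r] \<rightarrow> [m]\<close> followed by \<open>\<alpha>\<close> is \<open>map (nth \<alpha>) \<beta>\<close>.
\<close>

definition mon :: "nat \<Rightarrow> nat \<Rightarrow> nat list set" where
  "mon m n = {\<alpha>. length \<alpha> = Suc m \<and> sorted \<alpha> \<and> set \<alpha> \<subseteq> {0..n}}"

definition mon_surj :: "nat \<Rightarrow> nat \<Rightarrow> nat list set" where
  "mon_surj m n = {\<alpha> \<in> mon m n. set \<alpha> = {0..n}}"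

text \<open>
  \<open>pull X n \<alpha> x\<close> is the simplex \<open>x(\<alpha>)\<close> for an \<open>n\<close>-simplex \<open>x\<close>.  The sets of simplices
  of different dimensions may overlap, hence the argument \<open>n\<close>.
\<close>

record 'a sset =
  simplices :: "nat \<Rightarrow> 'a set"
  pull :: "nat \<Rightarrow> nat list \<Rightarrow> 'a \<Rightarrow> 'a"

locale simplicial_set =
  fixes X :: "'a sset"
  assumes pull_closed:
      "\<lbrakk>x \<in> simplices X n; \<alpha> \<in> mon m n\<rbrakk> \<Longrightarrow> pull X n \<alpha> x \<in> simplices X m"
    and pull_id: "x \<in> simplices X n \<Longrightarrow> pull X n [0..<Suc n] x = x"
    and pull_comp:
      "\<lbrakk>x \<in> simplices X n; \<alpha> \<in> mon m n; \<beta> \<in> mon r m\<rbrakk>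
        \<Longrightarrow> pull X m \<beta> (pull X n \<alpha> x) = pull X n (map (nth \<alpha>) \<beta>) x"

definition sprod :: "'a sset \<Rightarrow> 'b sset \<Rightarrow> ('a \<times> 'b) sset"  (infixr \<open>\<times>\<^sub>s\<close> 75) where
  "X \<times>\<^sub>s Y = \<lparr>simplices = (\<lambda>n. simplices X n \<times> simplices Y n),
             pull = (\<lambda>n \<alpha>. map_prod (pull X n \<alpha>) (pull Y n \<alpha>))\<rparr>"

lemma simplicial_set_sprod:
  assumes "simplicial_set X" "simplicial_set Y"
  shows "simplicial_set (X \<times>\<^sub>s Y)"
proof -
  interpret X: simplicial_set X by fact
  interpret Y: simplicial_set Y by fact
  show ?thesis
    by unfold_locales
      (auto simp: sprod_def X.pull_closed Y.pull_closed X.pull_id Y.pull_id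
        X.pull_comp Y.pull_comp simp del: upt_Suc)
qed

definition degenerate :: "'a sset \<Rightarrow> nat \<Rightarrow> 'a \<Rightarrow> bool" where
  "degenerate X n x \<longleftrightarrow>
    (\<exists>m<n. \<exists>y\<in>simplices X m. \<exists>\<sigma>\<in>mon_surj n m. x = pull X m \<sigma> y)"


section \<open>Free modules\<close>

text \<open>
  The type \<open>'b \<Rightarrow>\<^sub>0 'k\<close> is the free module on \<open>'b\<close>.  The sort used for the coefficients is that
  of commutative rings with unit; unlike \<^class>\<open>comm_ring_1\<close> it admits the zero ring.
\<close>

definition smul :: "'k \<Rightarrow> ('b \<Rightarrow>\<^sub>0 'k) \<Rightarrow> 'b \<Rightarrow>\<^sub>0 'k::{comm_ring,comm_monoid_mult}" where
  "smul r c = Poly_Mapping.map ((*) r) c"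

definition basis :: "'b \<Rightarrow> 'b \<Rightarrow>\<^sub>0 'k::{comm_ring,comm_monoid_mult}" where
  "basis b = Poly_Mapping.single b 1"

definition free_on :: "'b set \<Rightarrow> ('b \<Rightarrow>\<^sub>0 'k::{comm_ring,comm_monoid_mult}) set" where
  "free_on B = {c. Poly_Mapping.keys c \<subseteq> B}"

text \<open>\<open>lin \<phi>\<close> is the linear map taking each basis element \<open>b\<close> to \<open>\<phi> b\<close>.\<close>

definition lin ::
    "('b \<Rightarrow> 'c \<Rightarrow>\<^sub>0 'k) \<Rightarrow> ('b \<Rightarrow>\<^sub>0 'k) \<Rightarrow> 'c \<Rightarrow>\<^sub>0 'k::{comm_ring,comm_monoid_mult}" where
  "lin \<phi> c = (\<Sum>b\<in>Poly_Mapping.keys c. smul (Poly_Mapping.lookup c b) (\<phi> b))"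

definition relabel ::
    "('b \<Rightarrow> 'c) \<Rightarrow> ('b \<Rightarrow>\<^sub>0 'k) \<Rightarrow> 'c \<Rightarrow>\<^sub>0 'k::{comm_ring,comm_monoid_mult}" where
  "relabel h = lin (\<lambda>b. basis (h b))"

definition linear_map ::
    "(('b \<Rightarrow>\<^sub>0 'k) \<Rightarrow> 'c \<Rightarrow>\<^sub>0 'k::{comm_ring,comm_monoid_mult}) \<Rightarrow> bool" where
  "linear_map f \<longleftrightarrow> (\<forall>c d. f (c + d) = f c + f d) \<and> (\<forall>r c. f (smul r c) = smul r (f c))"

lemma lookup_smul: "Poly_Mapping.lookup (smul r c) b = r * Poly_Mapping.lookup c b"
  by (simp add: smul_def Poly_Mapping.map.rep_eq when_def)

lemma smul_simps:
  fixes r s :: "'k::{comm_ring,comm_monoid_mult}"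
  shows "smul 1 c = c" "smul 0 c = 0" "smul r 0 = 0" "smul r (smul s c) = smul (r * s) c"
    "smul r (c + d) = smul r c + smul r d" "smul (r + s) c = smul r c + smul s c"
  by (simp_all add: poly_mapping_eq_iff fun_eq_iff lookup_smul lookup_add mult.assoc
      distrib_left distrib_right)

lemma smul_sum: "smul r (sum f A) = (\<Sum>a\<in>A. smul r (f a))"
  by (induction A rule: infinite_finite_induct) (simp_all add: smul_simps)

lemma lin_superset:
  assumes "finite A" "Poly_Mapping.keys c \<subseteq> A"
  shows "lin \<phi> c = (\<Sum>b\<in>A. smul (Poly_Mapping.lookup c b) (\<phi> b))"
  unfolding lin_def using assms
  by (intro sum.mono_neutral_left) (auto simp: in_keys_iff smul_simps)

lemma linear_map_lin:
  fixes \<phi> :: "'b \<Rightarrow> 'c \<Rightarrow>\<^sub>0 'k::{comm_ring,comm_monoid_mult}"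
  shows "linear_map (lin \<phi>)"
  unfolding linear_map_def
proof (intro conjI allI)
  fix c d :: "'b \<Rightarrow>\<^sub>0 'k" and r
  let ?A = "Poly_Mapping.keys c \<union> Poly_Mapping.keys d"
  have "lin \<phi> (c + d) = (\<Sum>b\<in>?A. smul (Poly_Mapping.lookup (c + d) b) (\<phi> b))"
    by (rule lin_superset) (auto dest: subsetD[OF Poly_Mapping.keys_add])
  also have "\<dots> = lin \<phi> c + lin \<phi> d"
    by (simp add: lin_superset[of ?A] lookup_add smul_simps sum.distrib)
  finally show "lin \<phi> (c + d) = lin \<phi> c + lin \<phi> d" .
  have "lin \<phi> (smul r c) =
      (\<Sum>b\<in>Poly_Mapping.keys c. smul (Poly_Mapping.lookup (smul r c) b) (\<phi> b))"
    by (rule lin_superset) (auto simp: in_keys_iff lookup_smul)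
  then show "lin \<phi> (smul r c) = smul r (lin \<phi> c)"
    by (simp add: lin_def lookup_smul smul_simps smul_sum)
qed

lemma lin_basis: "lin \<phi> (basis b) = \<phi> b"
proof -
  have "lin \<phi> (basis b) = (\<Sum>b'\<in>{b}. smul (Poly_Mapping.lookup (basis b) b') (\<phi> b'))"
    by (rule lin_superset) (auto simp: basis_def)
  then show ?thesis by (simp add: basis_def smul_simps)
qed

lemma lin_basis_id: "lin basis c = c"
proof (rule poly_mapping_eqI)
  fix b
  have "Poly_Mapping.lookup (lin basis c) b
      = (\<Sum>a\<in>Poly_Mapping.keys c. if a = b then Poly_Mapping.lookup c a else 0)"
    unfolding lin_def lookup_sum
    by (rule sum.cong) (auto simp: lookup_smul basis_def lookup_single)
  also have "\<dots> = Poly_Mapping.lookup c b" by (simp add: in_keys_iff)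
  finally show "Poly_Mapping.lookup (lin basis c) b = Poly_Mapping.lookup c b" .
qed

lemma linear_map_sum:
  assumes "linear_map f"
  shows "f (\<Sum>a\<in>A. smul (r a) (c a)) = (\<Sum>a\<in>A. smul (r a) (f (c a)))"
proof -
  have "f 0 = 0" using assms unfolding linear_map_def by (metis smul_simps(2))
  then show ?thesis
    using assms by (induction A rule: infinite_finite_induct) (auto simp: linear_map_def)
qed

lemma linear_map_eq_lin:
  assumes "linear_map f"
  shows "f c = lin (\<lambda>b. f (basis b)) c"
  using linear_map_sum[OF assms, of "Poly_Mapping.lookup c" basis "Poly_Mapping.keys c"]
    lin_basis_id[of c]
  by (simp add: lin_def)


section \<open>Tensor products\<close>

text \<open>
  All modules considered are free with a given basis.  The tensor product of the free modules
  on \<open>B\<close> and \<open>C\<close> is taken to be the free module on \<open>B \<times> C\<close>, together with the bilinear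
  map \<open>tens\<close>; the \<open>l\<close>-th tensor power of the free module on \<open>B\<close> is the free module
  on lists of length \<open>l\<close> over \<open>B\<close>.
\<close>

definition tens ::
    "('b \<Rightarrow>\<^sub>0 'k) \<Rightarrow> ('c \<Rightarrow>\<^sub>0 'k) \<Rightarrow> 'b \<times> 'c \<Rightarrow>\<^sub>0 'k::{comm_ring,comm_monoid_mult}" where
  "tens c d = lin (\<lambda>a. lin (\<lambda>b. basis (a, b)) d) c"

fun tens_list :: "('b \<Rightarrow>\<^sub>0 'k) list \<Rightarrow> 'b list \<Rightarrow>\<^sub>0 'k::{comm_ring,comm_monoid_mult}" where
  "tens_list [] = basis []"
| "tens_list (c # cs) = relabel (\<lambda>(b, bs). b # bs) (tens c (tens_list cs))"

text \<open>
  \<open>tensor_map deg n f g\<close> is \<open>f \<otimes> g\<close> with the Koszul sign, where \<open>deg\<close> gives the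
  degrees of the basis elements in the domain of \<open>f\<close>, and \<open>n\<close> is the degree of \<open>g\<close>.
\<close>

definition tensor_map ::
    "('b \<Rightarrow> nat) \<Rightarrow> nat \<Rightarrow> (('b \<Rightarrow>\<^sub>0 'k) \<Rightarrow> 'd \<Rightarrow>\<^sub>0 'k) \<Rightarrow> (('c \<Rightarrow>\<^sub>0 'k) \<Rightarrow> 'e \<Rightarrow>\<^sub>0 'k)
      \<Rightarrow> ('b \<times> 'c \<Rightarrow>\<^sub>0 'k) \<Rightarrow> 'd \<times> 'e \<Rightarrow>\<^sub>0 'k::{comm_ring,comm_monoid_mult}" where
  "tensor_map deg n f g =
    lin (\<lambda>(a, b). smul ((- 1) ^ (n * deg a)) (tens (f (basis a)) (g (basis b))))"

text \<open>The tensor power of a map of degree \<open>0\<close>; no signs occur.\<close>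

definition tensor_power_map ::
    "(('b \<Rightarrow>\<^sub>0 'k) \<Rightarrow> 'd \<Rightarrow>\<^sub>0 'k) \<Rightarrow> ('b list \<Rightarrow>\<^sub>0 'k) \<Rightarrow> 'd list \<Rightarrow>\<^sub>0 'k::{comm_ring,comm_monoid_mult}"
  where
  "tensor_power_map f = lin (\<lambda>bs. tens_list (map (\<lambda>b. f (basis b)) bs))"

lemma linear_map_comp: "linear_map f \<Longrightarrow> linear_map g \<Longrightarrow> linear_map (\<lambda>c. f (g c))"
  by (simp add: linear_map_def)

lemma linear_map_smul: "linear_map (smul r)"
  by (simp add: linear_map_def smul_simps mult.commute)

lemma linear_map_tens_left: "linear_map (\<lambda>c. tens c d)"
  unfolding tens_def by (rule linear_map_lin)

lemma linear_map_tens_right: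
  fixes c :: "'b \<Rightarrow>\<^sub>0 'k::{comm_ring,comm_monoid_mult}"
  shows "linear_map (tens c :: ('c \<Rightarrow>\<^sub>0 'k) \<Rightarrow> _)"
proof -
  define P where "P a = lin (\<lambda>b::'c. basis (a, b) :: 'b \<times> 'c \<Rightarrow>\<^sub>0 'k)" for a :: 'b
  have P: "P a (d + d') = P a d + P a d'" "P a (smul r d) = smul r (P a d)" for a r d d'
    using linear_map_lin[of "\<lambda>b::'c. basis (a, b) :: 'b \<times> 'c \<Rightarrow>\<^sub>0 'k"]
    by (auto simp: linear_map_def P_def)
  have "tens c d = (\<Sum>a\<in>Poly_Mapping.keys c. smul (Poly_Mapping.lookup c a) (P a d))"
    for d :: "'c \<Rightarrow>\<^sub>0 'k"
    by (simp add: tens_def lin_def P_def)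
  then show ?thesis
    by (simp add: linear_map_def P smul_simps smul_sum sum.distrib mult.commute)
qed

lemma tens_basis: "tens (basis a) (basis b) = basis (a, b)"
  by (simp add: tens_def lin_basis)

lemma tensor_map_koszul:
  assumes f: "linear_map f" and g: "linear_map g"
    and deg: "\<And>a. a \<in> Poly_Mapping.keys c \<Longrightarrow> deg a = m"
  shows "tensor_map deg n f g (tens c d) = smul ((- 1) ^ (n * m)) (tens (f c) (g d))"
proof -
  let ?T = "tensor_map deg n f g"
  have T: "linear_map ?T" unfolding tensor_map_def by (rule linear_map_lin)
  have 1: "?T (tens (basis a) d) = smul ((- 1) ^ (n * m)) (tens (f (basis a)) (g d))"
    if "a \<in> Poly_Mapping.keys c" for a
  proof -
    have "?T (tens (basis a) d) = lin (\<lambda>b. ?T (tens (basis a) (basis b))) d"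
      by (rule linear_map_eq_lin[OF linear_map_comp[OF T linear_map_tens_right]])
    also have "\<dots> = lin (\<lambda>b. smul ((- 1) ^ (n * m)) (tens (f (basis a)) (g (basis b)))) d"
      by (simp add: tens_basis tensor_map_def lin_basis deg[OF that])
    also have "\<dots> = smul ((- 1) ^ (n * m)) (tens (f (basis a)) (g d))"
      by (rule linear_map_eq_lin[symmetric, OF linear_map_comp[OF linear_map_smul
            linear_map_comp[OF linear_map_tens_right g]]])
    finally show ?thesis .
  qed
  have "?T (tens c d) = lin (\<lambda>a. ?T (tens (basis a) d)) c"
    by (rule linear_map_eq_lin[OF linear_map_comp[OF T linear_map_tens_left]])
  also have "\<dots> = lin (\<lambda>a. smul ((- 1) ^ (n * m)) (tens (f (basis a)) (g d))) c"
    by (simp add: lin_def 1)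
  also have "\<dots> = smul ((- 1) ^ (n * m)) (tens (f c) (g d))"
    by (rule linear_map_eq_lin[symmetric, OF linear_map_comp[OF linear_map_smul
          linear_map_comp[OF linear_map_tens_left f]]])
  finally show ?thesis .
qed


section \<open>Normalized chains\<close>

text \<open>
  A simplex together with its dimension is a \<open>cell\<close>.  The normalized chain complex (the free
  module on all cells modulo the degenerate ones) is realized as the free module on the
  nondegenerate cells; \<open>cls X (n, x)\<close> is the class of the \<open>n\<close>-simplex \<open>x\<close>.  See
  \<open>normalization\<close> below for the comparison.  The differential plays no role.
\<close>

type_synonym 'a cell = "nat \<times> 'a"

definition cells :: "'a sset \<Rightarrow> 'a cell set" where
  "cells X = {(n, x). x \<in> simplices X n}"

definition nondeg :: "'a sset \<Rightarrow> 'a cell set" where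
  "nondeg X = {(n, x). x \<in> simplices X n \<and> \<not> degenerate X n x}"

definition chains :: "'a sset \<Rightarrow> ('a cell \<Rightarrow>\<^sub>0 'k::{comm_ring,comm_monoid_mult}) set" where
  "chains X = free_on (nondeg X)"

definition cls :: "'a sset \<Rightarrow> 'a cell \<Rightarrow> 'a cell \<Rightarrow>\<^sub>0 'k::{comm_ring,comm_monoid_mult}" where
  "cls X = (\<lambda>(n, x). if degenerate X n x then 0 else basis (n, x))"

lemma lookup_lin_cls:
  "Poly_Mapping.lookup (lin (cls X) c) (n, x) =
    (if degenerate X n x then 0 else Poly_Mapping.lookup c (n, x))"
proof -
  have "Poly_Mapping.lookup (lin (cls X) c) (n, x)
      = (\<Sum>a\<in>Poly_Mapping.keys c. if a = (n, x) then
          (if degenerate X n x then 0 else Poly_Mapping.lookup c (n, x)) else 0)"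
    unfolding lin_def lookup_sum
    by (rule sum.cong) (auto simp: lookup_smul basis_def cls_def lookup_single when_def split: if_splits)
  then show ?thesis by (auto simp: in_keys_iff)
qed

lemma normalization:
  fixes X :: "'a sset"
  shows "lin (cls X) ` free_on (cells X)
      = (chains X :: ('a cell \<Rightarrow>\<^sub>0 'k::{comm_ring,comm_monoid_mult}) set)"
    and "{c \<in> free_on (cells X). lin (cls X) c = (0 :: 'a cell \<Rightarrow>\<^sub>0 'k)}
      = free_on {(n, x). x \<in> simplices X n \<and> degenerate X n x}"
proof -
  show "lin (cls X) ` free_on (cells X) = (chains X :: ('a cell \<Rightarrow>\<^sub>0 'k) set)"
  proof (intro equalityI subsetI)
    fix c :: "'a cell \<Rightarrow>\<^sub>0 'k" assume "c \<in> lin (cls X) ` free_on (cells X)"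
    then show "c \<in> chains X"
      by (auto simp: free_on_def chains_def nondeg_def cells_def in_keys_iff subset_iff
          lookup_lin_cls split: if_splits)
  next
    fix c :: "'a cell \<Rightarrow>\<^sub>0 'k" assume c: "c \<in> chains X"
    then have "Poly_Mapping.lookup c (n, x) = 0" if "degenerate X n x" for n x
      using that by (force simp: free_on_def chains_def nondeg_def in_keys_iff)
    then have "lin (cls X) c = c"
      by (intro poly_mapping_eqI) (auto simp: lookup_lin_cls split: prod.splits)
    moreover have "c \<in> free_on (cells X)"
      using c by (auto simp: free_on_def chains_def nondeg_def cells_def)
    ultimately show "c \<in> lin (cls X) ` free_on (cells X)" by force
  qed
  show "{c \<in> free_on (cells X). lin (cls X) c = (0 :: 'a cell \<Rightarrow>\<^sub>0 'k)}
      = free_on {(n, x). x \<in> simplices X n \<and> degenerate X n x}"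
    by (auto simp: free_on_def cells_def in_keys_iff poly_mapping_eq_iff fun_eq_iff
        lookup_lin_cls subset_iff split: if_splits)
qed

text \<open>The chain map into \<open>C(Y)\<close> induced by a dimension preserving map \<open>h\<close> on simplices.\<close>

definition push :: "'b sset \<Rightarrow> ('a \<Rightarrow> 'b)
    \<Rightarrow> ('a cell \<Rightarrow>\<^sub>0 'k) \<Rightarrow> 'b cell \<Rightarrow>\<^sub>0 'k::{comm_ring,comm_monoid_mult}" where
  "push Y h = lin (\<lambda>(n, x). cls Y (n, h x))"


section \<open>The shuffle map\<close>

definition shuffle_pairs :: "nat \<Rightarrow> nat \<Rightarrow> (nat list \<times> nat list) set" where
  "shuffle_pairs p q = {(\<alpha>, \<beta>). \<alpha> \<in> mon_surj (p + q) p \<and> \<beta> \<in> mon_surj (p + q) q \<and>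
    (\<forall>i\<in>{1..p + q}.
      \<alpha> ! i = \<alpha> ! (i - 1) + 1 \<and> \<beta> ! i = \<beta> ! (i - 1) \<or>
      \<alpha> ! i = \<alpha> ! (i - 1) \<and> \<beta> ! i = \<beta> ! (i - 1) + 1)}"

text \<open>
  The step \<open>i - 1 \<rightarrow> i\<close> is moved to position \<open>\<alpha> i\<close> if \<open>\<alpha>\<close> increases there, and
  to position \<open>p + \<beta> i\<close> if \<open>\<beta>\<close> does.
\<close>

definition shuffle_perm :: "nat \<Rightarrow> nat \<Rightarrow> nat list \<Rightarrow> nat list \<Rightarrow> nat \<Rightarrow> nat" where
  "shuffle_perm p q \<alpha> \<beta> i =
    (if i \<in> {1..p + q} then if \<alpha> ! i = \<alpha> ! (i - 1) + 1 then \<alpha> ! i else p + \<beta> ! i else i)"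

definition shuffle_sign ::
    "nat \<Rightarrow> nat \<Rightarrow> nat list \<Rightarrow> nat list \<Rightarrow> 'k::{comm_ring,comm_monoid_mult}" where
  "shuffle_sign p q \<alpha> \<beta> = (if sign (shuffle_perm p q \<alpha> \<beta>) = 1 then 1 else - 1)"

definition shuffle_map :: "'a sset \<Rightarrow> 'b sset
    \<Rightarrow> ('a cell \<times> 'b cell \<Rightarrow>\<^sub>0 'k) \<Rightarrow> ('a \<times> 'b) cell \<Rightarrow>\<^sub>0 'k::{comm_ring,comm_monoid_mult}" where
  "shuffle_map X Y = lin (\<lambda>((p, x), (q, y)).
    \<Sum>(\<alpha>, \<beta>)\<in>shuffle_pairs p q.
      smul (shuffle_sign p q \<alpha> \<beta>) (cls (X \<times>\<^sub>s Y) (p + q, (pull X p \<alpha> x, pull Y q \<beta> y))))"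


section \<open>Interval cut operations\<close>

text \<open>Only the values of \<open>u\<close> on \<open>{1..k + l}\<close> matter.\<close>

definition nondeg_surj :: "nat \<Rightarrow> nat \<Rightarrow> (nat \<Rightarrow> nat) \<Rightarrow> bool" where
  "nondeg_surj k l u \<longleftrightarrow> u ` {1..k + l} = {1..l} \<and> (\<forall>i. 1 \<le> i \<and> i < k + l \<longrightarrow> u i \<noteq> u (i + 1))"

definition one_biased :: "nat \<Rightarrow> nat \<Rightarrow> (nat \<Rightarrow> nat) \<Rightarrow> bool" where
  "one_biased k l u \<longleftrightarrow> nondeg_surj k l u \<and>
    (\<forall>i\<in>{1..k + l}. \<forall>j\<in>{1..k + l}. i \<noteq> j \<and> u i = u j \<longrightarrow> u i = 1)"

text \<open>
  In the following, \<open>m = k + l\<close> is the number of intervals.  A cut of \<open>[n]\<close> is the list of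
  \<open>0 = p 0 \<le> p 1 \<le> \<dots> \<le> p m = n\<close>, and the interval with index \<open>i \<in> {1..m}\<close> runs
  from \<open>p (i - 1)\<close> to \<open>p i\<close>.
\<close>

definition cuts :: "nat \<Rightarrow> nat \<Rightarrow> nat list set" where
  "cuts m n = {p. length p = Suc m \<and> sorted p \<and> p ! 0 = 0 \<and> p ! m = n}"

definition final_interval :: "nat \<Rightarrow> (nat \<Rightarrow> nat) \<Rightarrow> nat \<Rightarrow> bool" where
  "final_interval m u i \<longleftrightarrow> (\<forall>j. i < j \<and> j \<le> m \<longrightarrow> u j \<noteq> u i)"

definition interval_length :: "nat \<Rightarrow> (nat \<Rightarrow> nat) \<Rightarrow> nat list \<Rightarrow> nat \<Rightarrow> nat" where
  "interval_length m u p i =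
    (if final_interval m u i then p ! i - p ! (i - 1) else p ! i - p ! (i - 1) + 1)"

text \<open>
  Reordering the intervals stably by their values under \<open>u\<close> interchanges exactly the pairs
  \<open>i < j\<close> with \<open>u i > u j\<close>, each contributing the product of the two lengths.
\<close>

definition perm_sign ::
    "nat \<Rightarrow> (nat \<Rightarrow> nat) \<Rightarrow> nat list \<Rightarrow> 'k::{comm_ring,comm_monoid_mult}" where
  "perm_sign m u p =
    (\<Prod>(i, j)\<in>{(i, j). 1 \<le> i \<and> i < j \<and> j \<le> m \<and> u i > u j}.
      (- 1) ^ (interval_length m u p i * interval_length m u p j))"

definition pos_sign ::
    "nat \<Rightarrow> (nat \<Rightarrow> nat) \<Rightarrow> nat list \<Rightarrow> 'k::{comm_ring,comm_monoid_mult}" where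
  "pos_sign m u p = (\<Prod>i\<in>{i\<in>{1..m}. \<not> final_interval m u i}. (- 1) ^ (p ! i))"

definition cut_vertices :: "nat \<Rightarrow> (nat \<Rightarrow> nat) \<Rightarrow> nat list \<Rightarrow> nat \<Rightarrow> nat list" where
  "cut_vertices m u p s = concat [[p ! (i - 1)..<Suc (p ! i)]. i \<leftarrow> [1..<Suc m], u i = s]"

definition AW :: "nat \<Rightarrow> nat \<Rightarrow> (nat \<Rightarrow> nat) \<Rightarrow> 'a sset
    \<Rightarrow> ('a cell \<Rightarrow>\<^sub>0 'k) \<Rightarrow> 'a cell list \<Rightarrow>\<^sub>0 'k::{comm_ring,comm_monoid_mult}" where
  "AW k l u X = lin (\<lambda>(n, x). \<Sum>p\<in>cuts (k + l) n.
    smul (perm_sign (k + l) u p * pos_sign (k + l) u p)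
      (tens_list [cls X (length \<nu> - 1, pull X n \<nu> x).
        \<nu> \<leftarrow> map (cut_vertices (k + l) u p) [1..<Suc l]]))"

text \<open>
  The relabelling is the identification of the \<open>(l + 1)\<close>-st tensor power of \<open>C(X \<times> Y)\<close> with
  the tensor product of \<open>C(X \<times> Y)\<close> and its \<open>l\<close>-th tensor power.
\<close>

definition AW_tilde :: "nat \<Rightarrow> nat \<Rightarrow> (nat \<Rightarrow> nat) \<Rightarrow> 'a sset \<Rightarrow> 'b sset
    \<Rightarrow> (('a \<times> 'b) cell \<Rightarrow>\<^sub>0 'k) \<Rightarrow> 'a cell \<times> 'b cell list \<Rightarrow>\<^sub>0 'k::{comm_ring,comm_monoid_mult}"
  where
  "AW_tilde k l u X Y =
    tensor_map fst 0 (push X fst) (tensor_power_map (push Y snd))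
      \<circ> relabel (\<lambda>bs. (hd bs, tl bs)) \<circ> AW k (l + 1) u (X \<times>\<^sub>s Y)"


section \<open>Associativity\<close>

definition assoc :: "'a \<times> 'b \<times> 'c \<Rightarrow> ('a \<times> 'b) \<times> 'c" where
  "assoc = (\<lambda>(a, b, c). ((a, b), c))"

definition chains_assoc :: "'a sset \<Rightarrow> 'b sset \<Rightarrow> 'c sset
    \<Rightarrow> (('a \<times> 'b \<times> 'c) cell \<Rightarrow>\<^sub>0 'k) \<Rightarrow> (('a \<times> 'b) \<times> 'c) cell \<Rightarrow>\<^sub>0 'k::{comm_ring,comm_monoid_mult}"
  where
  "chains_assoc X Y Z = push ((X \<times>\<^sub>s Y) \<times>\<^sub>s Z) assoc"

definition tensor_assoc ::
    "('a \<times> 'b \<times> 'c \<Rightarrow>\<^sub>0 'k) \<Rightarrow> ('a \<times> 'b) \<times> 'c \<Rightarrow>\<^sub>0 'k::{comm_ring,comm_monoid_mult}" where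
  "tensor_assoc = relabel assoc"

end

theory Submission
  imports Defs
begin

text \<open>
  Take \<open>x \<otimes> (y, z)\<close>, a shuffle \<open>(\<lambda>, \<mu>)\<close> and a cut of \<open>[p + q]\<close>.  An interval with \<open>u\<close>-value
  \<open>s \<noteq> 1\<close> is the only one with that value, so the corresponding factor \<open>z(\<mu>(\<nu>\<^sub>s))\<close> is degenerate
  as soon as \<open>\<lambda>\<close> increases in that interval.  In the remaining terms \<open>\<lambda>\<close> increases only in the
  intervals with value \<open>1\<close>; applying \<open>\<mu>\<close> to the cut points gives a cut of \<open>[q]\<close>, and
  restricting \<open>(\<lambda>, \<mu>)\<close> to \<open>\<nu>\<^sub>1\<close>, where each jump between consecutive such intervals counts as one
  increase of \<open>\<mu>\<close>, gives a shuffle as in the other composite.  This is a bijection,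
  and it preserves the simplices.  As for the signs, moving \<open>x\<close> past the other
  intervals is accounted for by the permutation sign, and each of the \<open>p\<close> steps of \<open>\<lambda>\<close> contributes
  \<open>(-1)\<^sup>k\<close>, in part by the jumps before it and in part by the position sign
  of the inner intervals ending after it; this gives the Koszul sign \<open>(-1)\<^sup>k\<^sup>p\<close>.
\<close>

section \<open>Shuffles as words\<close>

text \<open>
  A shuffle \<open>(\<lambda>, \<mu>)\<close> is encoded by the word of its steps, the letter being \<open>True\<close> if \<open>\<lambda>\<close>
  increases and \<open>False\<close> if \<open>\<mu>\<close> does; then \<open>\<lambda> = walk True 0 w\<close> and \<open>\<mu> = walk False 0 w\<close>.
\<close>

primrec walk :: "bool \<Rightarrow> nat \<Rightarrow> bool list \<Rightarrow> nat list" where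
  "walk b n [] = [n]"
| "walk b n (c # w) = n # walk b (if c = b then Suc n else n) w"

text \<open>These are the inversions of \<open>shuffle_perm\<close>: the pairs in which a step of
  \<mu> precedes a step of \<lambda>.\<close>

primrec inversions :: "bool list \<Rightarrow> nat" where
  "inversions [] = 0"
| "inversions (c # w) = (if c then 0 else count_list w True) + inversions w"

definition words :: "nat \<Rightarrow> nat \<Rightarrow> bool list set" where
  "words p q = {w. count_list w True = p \<and> count_list w False = q}"

section \<open>Vertices and steps of a walk\<close>

lemma length_walk [simp]: "length (walk b n w) = Suc (length w)"
  by (induction w arbitrary: n) auto

lemma walk_nth: "i \<le> length w \<Longrightarrow> walk b n w ! i = n + count_list (take i w) b"
proof (induction w arbitrary: n i)
  case (Cons c w)
  then show ?case by (cases i) auto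
qed simp

text \<open>The letter \<open>c\<close> is the step from the last vertex of the first walk to the
  first vertex of the second, so the two lists share no entry. In \<open>ones\<close> such a step is
  a jump between intervals.\<close>

lemma walk_append: "walk b n (v @ c # w) =
    walk b n v @ walk b (n + count_list v b + (if c = b then 1 else 0)) w"
  by (induction v arbitrary: n) auto

lemma walk_shift: "walk b (d + n) w = map ((+) d) (walk b n w)"
proof (induction w arbitrary: n)
  case (Cons c w)
  from Cons[of "Suc n"] Cons[of n] show ?case by simp
qed simp

lemma walk_replicate: "walk b n (replicate a b) = [n..<Suc (n + a)]"
  by (induction a arbitrary: n) (simp_all add: upt_conv_Cons del: upt_Suc)

lemma walk_not_distinct:
  assumes "(\<not> b) \<in> set w" shows "\<not> distinct (walk b n w)"
  using assms
proof (induction w arbitrary: n)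
  case (Cons c w)
  have hd: "n \<in> set (walk b n w)" by (cases w) auto
  show ?case using Cons hd by auto
qed simp

lemma count_list_length: "count_list w True + count_list w False = length w"
  by (induction w) auto

lemma set_walk: "set (walk b n w) = {n..n + count_list w b}"
proof (induction w arbitrary: n)
  case (Cons c w) then show ?case by auto
qed simp

lemma sorted_walk: "sorted (walk b n w)"
proof (induction w arbitrary: n)
  case (Cons c w) then show ?case by (auto simp: set_walk)
qed simp

section \<open>The correspondence between words and shuffles\<close>

lemma walk_mon_surj:
  "w \<in> words p q \<Longrightarrow> walk True 0 w \<in> mon_surj (p + q) p"
  "w \<in> words p q \<Longrightarrow> walk False 0 w \<in> mon_surj (p + q) q"
  using count_list_length[of w]
  by (auto simp: words_def mon_surj_def mon_def set_walk sorted_walk)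

lemma walk_nth_Suc:
  "i < length w \<Longrightarrow> walk b n w ! Suc i = walk b n w ! i + (if w ! i = b then 1 else 0)"
  by (simp add: walk_nth take_Suc_conv_app_nth)

lemma walk_shuffle_pairs:
  assumes "w \<in> words p q"
  shows "(walk True 0 w, walk False 0 w) \<in> shuffle_pairs p q"
proof -
  have len: "length w = p + q" using assms count_list_length[of w] by (simp add: words_def)
  have "walk True 0 w ! i = walk True 0 w ! (i - 1) + 1 \<and> walk False 0 w ! i = walk False 0 w ! (i - 1) \<or>
      walk True 0 w ! i = walk True 0 w ! (i - 1) \<and> walk False 0 w ! i = walk False 0 w ! (i - 1) + 1"
    if "i \<in> {1..p + q}" for i
    using that len by (cases i) (auto simp: walk_nth_Suc)
  then show ?thesis by (simp add: shuffle_pairs_def walk_mon_surj[OF assms])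
qed

lemma mon_surj_nth_0:
  assumes "\<alpha> \<in> mon_surj m n" shows "\<alpha> ! 0 = 0"
proof -
  have "0 \<in> set \<alpha>" using assms by (simp add: mon_surj_def)
  then obtain i where "i < length \<alpha>" "\<alpha> ! i = 0" by (auto simp: in_set_conv_nth)
  with assms show ?thesis
    by (auto simp: mon_surj_def mon_def dest: sorted_nth_mono[of \<alpha> 0 i])
qed

lemma mon_surj_last:
  assumes "\<alpha> \<in> mon_surj m n" shows "\<alpha> ! m = n"
proof -
  have "n \<in> set \<alpha>" using assms by (simp add: mon_surj_def)
  then obtain i where "i < length \<alpha>" "\<alpha> ! i = n" by (auto simp: in_set_conv_nth)
  moreover have "\<alpha> ! m \<in> set \<alpha>" using assms by (auto simp: mon_surj_def mon_def)
  ultimately show ?thesis using assms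
    by (auto simp: mon_surj_def mon_def dest: sorted_nth_mono[of \<alpha> i m])
qed

text \<open>Both maps start at \<open>0\<close>, and the word recording where \<alpha> increases
  prescribes all further steps. The end values of \<alpha> and \<beta> count its letters.\<close>

lemma walk_surj:
  assumes "(\<alpha>, \<beta>) \<in> shuffle_pairs p q"
  obtains w where "w \<in> words p q" "\<alpha> = walk True 0 w" "\<beta> = walk False 0 w"
proof -
  let ?w = "map (\<lambda>i. \<alpha> ! Suc i = Suc (\<alpha> ! i)) [0..<p + q]"
  have a: "\<alpha> \<in> mon_surj (p + q) p" and b: "\<beta> \<in> mon_surj (p + q) q"
    using assms by (auto simp: shuffle_pairs_def)
  have st: "\<alpha> ! Suc i = Suc (\<alpha> ! i) \<and> \<beta> ! Suc i = \<beta> ! i \<or>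
      \<alpha> ! Suc i = \<alpha> ! i \<and> \<beta> ! Suc i = Suc (\<beta> ! i)" if "i < p + q" for i
  proof -
    have "Suc i \<in> {1..p + q}" using that by simp
    with assms show ?thesis unfolding shuffle_pairs_def by fastforce
  qed
  have nth: "i \<le> p + q \<Longrightarrow> \<alpha> ! i = walk True 0 ?w ! i \<and> \<beta> ! i = walk False 0 ?w ! i" for i
  proof (induction i)
    case 0
    then show ?case using mon_surj_nth_0[OF a] mon_surj_nth_0[OF b] by (simp add: walk_nth)
  next
    case (Suc i)
    then show ?case using st[of i] by (auto simp: walk_nth_Suc)
  qed
  have wa: "\<alpha> = walk True 0 ?w" "\<beta> = walk False 0 ?w"
    using a b nth by (auto intro!: nth_equalityI simp: mon_surj_def mon_def)
  have "walk True 0 ?w ! (p + q) = p" "walk False 0 ?w ! (p + q) = q"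
    using mon_surj_last[OF a] mon_surj_last[OF b] nth[of "p + q"] by auto
  then have "?w \<in> words p q" by (simp add: walk_nth words_def)
  with wa that show ?thesis by blast
qed

text \<open>A letter other than \<open>b\<close> repeats a vertex, so a single walk already shows
  every letter.\<close>

lemma walk_inj: "walk b n v = walk b n w \<Longrightarrow> v = w"
proof (induction v arbitrary: n w)
  case Nil
  then have "length (walk b n w) = Suc 0" by (metis length_walk list.size(3))
  then show ?case by simp
next
  case (Cons c v)
  then have "length (walk b n w) = Suc (Suc (length v))" by (metis length_walk length_Cons)
  then obtain d w' where w: "w = d # w'" by (cases w) auto
  have hd: "walk b i x ! 0 = i" for i x by (cases x) auto
  have "walk b (if c = b then Suc n else n) v = walk b (if d = b then Suc n else n) w'"
    using Cons.prems w by simp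
  moreover from this have "(c = b) = (d = b)" using hd by (metis n_not_Suc_n)
  ultimately show ?case using Cons.IH w by (auto split: if_splits)
qed

lemma bij_walk: "bij_betw (\<lambda>w. (walk True 0 w, walk False 0 w)) (words p q) (shuffle_pairs p q)"
  unfolding bij_betw_def
  by (auto intro!: inj_onI walk_shuffle_pairs dest: walk_inj elim!: walk_surj)

section \<open>Inversions and the sign of a shuffle\<close>

lemma inversions_append:
  "inversions (v @ w) = inversions v + inversions w + count_list v False * count_list w True"
  by (induction v) auto

text \<open>The cycle of length \<open>q + 1\<close> on \<open>{a..a + q}\<close> that brings the
  last element to the front.\<close>

definition cycle_up :: "nat \<Rightarrow> nat \<Rightarrow> nat \<Rightarrow> nat" where
  "cycle_up a q i = (if a \<le> i \<and> i < a + q then Suc i else if i = a + q then a else i)"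

text \<open>Writes the cycle as a product of \<open>q\<close> adjacent transpositions, which gives
  its sign by induction.\<close>

lemma cycle_up_Suc: "cycle_up a (Suc q) = cycle_up a q \<circ> Transposition.transpose (a + q) (Suc (a + q))"
  by (rule ext) (auto simp: cycle_up_def transpose_def)

lemma cycle_up_0: "cycle_up a 0 = id"
  by (rule ext) (auto simp: cycle_up_def)

lemma cycle_up_sign: "permutation (cycle_up a q) \<and> sign (cycle_up a q) = (- 1) ^ q"
proof (induction q)
  case (Suc q)
  have "permutation (Transposition.transpose (a + q) (Suc (a + q)))"
    "sign (Transposition.transpose (a + q) (Suc (a + q))) = - 1"
    by (simp_all add: permutation_swap_id sign_swap_id)
  with Suc show ?case
    unfolding cycle_up_Suc by (simp add: sign_compose permutation_compose del: comp_apply)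
qed (simp add: cycle_up_0 sign_id)

text \<open>
  Appending a letter \<open>False\<close> does not change the permutation, and appending \<open>True\<close> composes it with
  the cycle that inserts the new step before all \<open>q\<close> steps of \<open>\<mu>\<close>.
\<close>

lemma sign_shuffle_perm:
  assumes "w \<in> words p q"
  shows "permutation (shuffle_perm p q (walk True 0 w) (walk False 0 w)) \<and>
    sign (shuffle_perm p q (walk True 0 w) (walk False 0 w)) = (- 1) ^ inversions w"
  using assms
proof (induction w arbitrary: p q rule: rev_induct)
  case Nil
  then have "shuffle_perm p q (walk True 0 []) (walk False 0 []) = id"
    by (auto simp: words_def shuffle_perm_def)
  then show ?case by (simp add: sign_id)
next
  case (snoc c w)
  have len: "length w = count_list w True + count_list w False" by (simp add: count_list_length)
  have *: "walk b 0 (w @ [c]) = walk b 0 w @ [count_list w b + (if c = b then 1 else 0)]" for b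
    by (simp add: walk_append)
  have nth: "walk b 0 w ! i = count_list (take i w) b" if "i \<le> length w" for b i
    using that by (simp add: walk_nth)
  show ?case
  proof (cases c)
    case True
    define p' where "p' = count_list w True"
    have p: "p = Suc p'" "q = count_list w False" using snoc.prems True by (auto simp: words_def p'_def)
    have w: "w \<in> words p' q" by (simp add: words_def p'_def p)
    have len': "length w = p' + q" using len p p'_def by simp
    let ?s = "shuffle_perm p' q (walk True 0 w) (walk False 0 w)"
    have le: "count_list (take i w) True \<le> p'" "count_list (take i w) False \<le> q" for i
      using count_list_append[of "take i w" "drop i w"] unfolding p p'_def by auto
    \<comment> \<open>At such an \<open>i\<close> it is \<mu> that increases. Hence
      \<open>p' + \<mu> i\<close> is at least \<open>Suc p'\<close> and lies in the range that the
      cycle shifts by one.\<close>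
    have pos: "count_list (take i w) False \<ge> 1"
      if "1 \<le> i" "i \<le> p' + q" "count_list (take i w) True \<noteq> Suc (count_list (take (i - 1) w) True)" for i
    proof -
      obtain j where "i = Suc j" using \<open>1 \<le> i\<close> by (cases i) auto
      then show ?thesis using that len' by (auto simp: take_Suc_conv_app_nth split: if_splits)
    qed
    have "shuffle_perm p q (walk True 0 (w @ [c])) (walk False 0 (w @ [c])) = cycle_up (Suc p') q \<circ> ?s"
    proof
      fix i
      consider "i = 0" | "1 \<le> i" "i \<le> p' + q" | "i = Suc (p' + q)" | "i > Suc (p' + q)" by linarith
      then show "shuffle_perm p q (walk True 0 (w @ [c])) (walk False 0 (w @ [c])) i
          = (cycle_up (Suc p') q \<circ> ?s) i"
      proof cases
        case 2
        then show ?thesis using le[of i] pos[of i] unfolding * 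
          by (auto simp: shuffle_perm_def cycle_up_def nth_append len' nth p)
      next
        case 3
        then show ?thesis unfolding *
          using True by (auto simp: shuffle_perm_def cycle_up_def nth_append len' nth p p'_def)
      qed (auto simp: shuffle_perm_def cycle_up_def p)
    qed
    moreover have "inversions (w @ [c]) = inversions w + q"
      using True p by (simp add: inversions_append)
    ultimately show ?thesis using snoc.IH[OF w] cycle_up_sign[of "Suc p'" q]
      by (simp add: sign_compose permutation_compose power_add del: comp_apply)
  next
    case False
    define q' where "q' = count_list w False"
    have p: "q = Suc q'" "p = count_list w True" using snoc.prems False by (auto simp: words_def q'_def)
    have w: "w \<in> words p q'" by (simp add: words_def q'_def p)
    have len': "length w = p + q'" using len p q'_def by simp
    have "shuffle_perm p q (walk True 0 (w @ [c])) (walk False 0 (w @ [c]))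
      = shuffle_perm p q' (walk True 0 w) (walk False 0 w)"
    proof
      fix i
      consider "i = 0" | "1 \<le> i" "i \<le> p + q'" | "i = Suc (p + q')" | "i > Suc (p + q')" by linarith
      then show "shuffle_perm p q (walk True 0 (w @ [c])) (walk False 0 (w @ [c])) i
          = shuffle_perm p q' (walk True 0 w) (walk False 0 w) i"
      proof cases
        case 3
        then show ?thesis unfolding *
          using False by (auto simp: shuffle_perm_def nth_append len' nth p q'_def)
      qed (auto simp: * shuffle_perm_def nth_append len' p)
    qed
    moreover have "inversions (w @ [c]) = inversions w"
      using False by (simp add: inversions_append)
    ultimately show ?thesis using snoc.IH[OF w] by simp
  qed
qed

lemma minus_one_power_parity:
  assumes "even a = even b"
  shows "(- 1 :: 'k::{comm_ring,comm_monoid_mult}) ^ a = (- 1) ^ b"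
proof -
  have "(- 1 :: 'k) ^ n = (if even n then 1 else - 1)" for n by (induction n) auto
  then show ?thesis using assms by simp
qed

lemma shuffle_sign_walk:
  assumes "w \<in> words p q"
  shows "shuffle_sign p q (walk True 0 w) (walk False 0 w)
    = (- 1 :: 'k::{comm_ring,comm_monoid_mult}) ^ inversions w"
proof -
  \<comment> \<open>The case distinction is made on integers, where \<open>1\<close> and
    \<open>- 1\<close> differ, so it is also valid over rings in which they coincide.\<close>
  have "(- 1 :: 'k) ^ n = (if (- 1 :: int) ^ n = 1 then 1 else - 1)" for n
    by (induction n) (auto simp: minus_one_power_iff)
  then show ?thesis using sign_shuffle_perm[OF assms] by (simp add: shuffle_sign_def)
qed

section \<open>Cutting a shuffle into pieces\<close>

text \<open>Encodes a cut by the lengths of its intervals, which can be chosen independently of each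
  other.\<close>

definition psums :: "nat \<Rightarrow> (nat \<Rightarrow> nat) \<Rightarrow> nat list" where
  "psums m a = map (\<lambda>i. \<Sum>j\<in>{1..i}. a j) [0..<Suc m]"

lemma psums_nth: "i \<le> m \<Longrightarrow> psums m a ! i = (\<Sum>j\<in>{1..i}. a j)"
  by (simp add: psums_def nth_append del: upt_Suc)

lemma psums_cuts: "psums m a \<in> cuts m (\<Sum>j\<in>{1..m}. a j)"
proof -
  have "sorted (psums m a)"
    unfolding sorted_iff_nth_mono
    by (auto simp: psums_def nth_append intro!: sum_mono2 simp del: upt_Suc)
  then show ?thesis by (simp add: cuts_def psums_nth) (simp add: psums_def)
qed

lemma cuts_mono:
  "p \<in> cuts m n \<Longrightarrow> i \<le> j \<Longrightarrow> j \<le> m \<Longrightarrow> p ! i \<le> p ! j"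
  by (auto simp: cuts_def sorted_iff_nth_mono)

lemma cuts_psums:
  assumes "p \<in> cuts m n"
  shows "p = psums m (\<lambda>j. p ! j - p ! (j - 1))"
proof (rule nth_equalityI)
  show "length p = length (psums m (\<lambda>j. p ! j - p ! (j - 1)))"
    using assms by (simp add: cuts_def psums_def)
  fix i assume "i < length p"
  then have "i \<le> m" using assms by (simp add: cuts_def)
  then show "p ! i = psums m (\<lambda>j. p ! j - p ! (j - 1)) ! i"
  proof (induction i)
    case 0 then show ?case using assms by (simp add: cuts_def psums_nth)
  next
    case (Suc i)
    with cuts_mono[OF assms, of i "Suc i"] show ?case by (simp add: psums_nth)
  qed
qed

lemma psums_diff: "1 \<le> i \<Longrightarrow> i \<le> m \<Longrightarrow> psums m a ! i - psums m a ! (i - 1) = a i"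
  by (cases i) (auto simp: psums_nth)

lemma finite_cuts: "finite (cuts m n)"
proof (rule finite_subset)
  show "cuts m n \<subseteq> {p. set p \<subseteq> {0..n} \<and> length p = Suc m}"
    using cuts_mono by (fastforce simp: cuts_def in_set_conv_nth)
  show "finite {p. set p \<subseteq> {0..n} \<and> length p = Suc m}" by (rule finite_lists_length_eq) simp
qed

lemma finite_words: "finite (words p q)"
proof (rule finite_subset)
  show "words p q \<subseteq> {w. set w \<subseteq> UNIV \<and> length w = p + q}"
    by (auto simp: words_def simp flip: count_list_length)
  show "finite {w :: bool list. set w \<subseteq> UNIV \<and> length w = p + q}"
    by (rule finite_lists_length_eq) simp
qed

text \<open>The same recursion serves for lists of vertices and for words. It splits off the last
  interval, so that cuts can be treated by induction on the number of intervals.\<close>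

primrec joined :: "(nat \<Rightarrow> bool) \<Rightarrow> (nat \<Rightarrow> 'a list) \<Rightarrow> nat \<Rightarrow> 'a list" where
  "joined S f 0 = []"
| "joined S f (Suc m) = joined S f m @ (if S (Suc m) then f (Suc m) else [])"

lemma cut_vertices_joined:
  "cut_vertices m u p s = joined (\<lambda>i. u i = s) (\<lambda>i. [p ! (i - 1)..<Suc (p ! i)]) m"
  by (induction m) (auto simp: cut_vertices_def)

lemma joined_cong:
  assumes "\<And>i. 1 \<le> i \<Longrightarrow> i \<le> m \<Longrightarrow> S i \<Longrightarrow> f i = g i"
  shows "joined S f m = joined S g m"
  using assms by (induction m) auto

lemma map_joined: "map h (joined S f m) = joined S (\<lambda>i. map h (f i)) m"
  by (induction m) auto

lemma length_joined: "length (joined S f m) = (\<Sum>i\<in>{1..m}. if S i then length (f i) else 0)"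
  by (induction m) auto

lemma count_list_joined:
  "count_list (joined S f m) b = (\<Sum>i\<in>{1..m}. if S i then count_list (f i) b else 0)"
  by (induction m) auto

lemma joined_empty_iff: "joined S f m = [] \<longleftrightarrow> (\<forall>i\<in>{1..m}. S i \<longrightarrow> f i = [])"
  by (induction m) (auto simp: atLeastAtMostSuc_conv)

lemma joined_split:
  assumes "1 \<le> i" "i \<le> m" "S i"
  shows "\<exists>r. joined S f m = joined S f (i - 1) @ f i @ r"
  using assms(2)
proof (induction m)
  case (Suc m)
  show ?case
  proof (cases "i = Suc m")
    case False
    with Suc obtain r where "joined S f m = joined S f (i - 1) @ f i @ r" by auto
    then show ?thesis by simp
  qed (use assms in auto)
qed (use assms in auto)

lemma distinct_joined:
  "distinct (joined S f m) \<Longrightarrow> 1 \<le> i \<Longrightarrow> i \<le> m \<Longrightarrow> S i \<Longrightarrow> distinct (f i)"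
  using joined_split[of i m S f] by auto

text \<open>
  Below, \<open>W i\<close> is the part of a shuffle word in the \<open>i\<close>-th interval of a cut, for \<open>1 \<le> i \<le> m\<close>.
  Then \<open>wcut\<close> is the cut itself and \<open>fcut\<close> its image under \<open>\<mu>\<close>.  In \<open>ones\<close> each letter
  \<open>False\<close> stands for the jump to the next interval with value \<open>1\<close>; the first one is superfluous,
  and the word of the restricted shuffle is \<open>tl (ones u W m)\<close>.
\<close>

abbreviation whole :: "(nat \<Rightarrow> bool list) \<Rightarrow> nat \<Rightarrow> bool list" where
  "whole W \<equiv> joined (\<lambda>_. True) W"

abbreviation ones :: "(nat \<Rightarrow> nat) \<Rightarrow> (nat \<Rightarrow> bool list) \<Rightarrow> nat \<Rightarrow> bool list" where
  "ones u W \<equiv> joined (\<lambda>i. u i = 1) (\<lambda>i. False # W i)"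

abbreviation wcut :: "nat \<Rightarrow> (nat \<Rightarrow> bool list) \<Rightarrow> nat list" where
  "wcut m W \<equiv> psums m (\<lambda>i. length (W i))"

abbreviation fcut :: "nat \<Rightarrow> (nat \<Rightarrow> bool list) \<Rightarrow> nat list" where
  "fcut m W \<equiv> psums m (\<lambda>i. count_list (W i) False)"

section \<open>Restriction of the two walks to the intervals of a cut\<close>

text \<open>The interval begins where the first \<open>i - 1\<close> pieces have been read; their
  letters \<open>b\<close> give the starting value, and from there on only the letters of
  \<open>W i\<close> matter.\<close>

lemma walk_interval:
  assumes "1 \<le> i" "i \<le> m"
  shows "map (nth (walk b 0 (whole W m))) [wcut m W ! (i - 1)..<Suc (wcut m W ! i)]
    = walk b (\<Sum>j\<in>{1..i - 1}. count_list (W j) b) (W i)"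
proof -
  obtain r where r: "whole W m = whole W (i - 1) @ W i @ r"
    using joined_split[of i m "\<lambda>_. True" W] assms by auto
  have P: "wcut m W ! (i - 1) = length (whole W (i - 1))"
    "wcut m W ! i = length (whole W (i - 1)) + length (W i)"
    using assms psums_diff[of i m "\<lambda>i. length (W i)"] cuts_mono[OF psums_cuts, of "i - 1" i m]
    by (auto simp: psums_nth length_joined) (cases i, auto simp: psums_nth)
  show ?thesis
  proof (rule nth_equalityI)
    fix t assume "t < length (map (nth (walk b 0 (whole W m))) [wcut m W ! (i - 1)..<Suc (wcut m W ! i)])"
    then have "t \<le> length (W i)" by (simp add: P[simplified] del: upt_Suc)
    then show "map (nth (walk b 0 (whole W m))) [wcut m W ! (i - 1)..<Suc (wcut m W ! i)] ! t
        = walk b (\<Sum>j\<in>{1..i - 1}. count_list (W j) b) (W i) ! t"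
      by (simp add: P[simplified] walk_nth r count_list_joined del: upt_Suc)
  qed (simp add: P[simplified] del: upt_Suc)
qed

lemma replicate_of_count:
  "True \<notin> set w \<Longrightarrow> w = replicate (count_list w False) False"
  by (induction w) auto

text \<open>In an interval without steps of \<lambda>, every step increases \<mu>, so \<mu> maps the
  interval bijectively onto the corresponding interval of the image cut.\<close>

lemma vertices_other:
  assumes "s \<noteq> 1" "\<And>i. 1 \<le> i \<Longrightarrow> i \<le> m \<Longrightarrow> u i \<noteq> 1 \<Longrightarrow> True \<notin> set (W i)"
  shows "map (nth (walk False 0 (whole W m))) (cut_vertices m u (wcut m W) s)
    = cut_vertices m u (fcut m W) s"
  unfolding cut_vertices_joined map_joined
proof (rule joined_cong)
  fix i assume i: "1 \<le> i" "i \<le> m" "u i = s"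
  define a where "a = count_list (W i) False"
  have "W i = replicate a False" unfolding a_def using i assms by (intro replicate_of_count) auto
  moreover have "fcut m W ! i = fcut m W ! (i - 1) + a"
    using i by (cases i) (auto simp: psums_nth a_def)
  ultimately show "map (nth (walk False 0 (whole W m))) [wcut m W ! (i - 1)..<Suc (wcut m W ! i)]
      = [fcut m W ! (i - 1)..<Suc (fcut m W ! i)]"
    unfolding walk_interval[OF i(1,2)] using i
    by (simp add: walk_replicate psums_nth del: upt_Suc)
qed

text \<open>\<lambda> is constant outside the intervals with value \<open>1\<close>, so the jump
  from one of these to the next repeats a vertex, just as a letter \<open>False\<close> does. The
  extra \<open>0\<close> accounts for the first letter of \<open>ones\<close>.\<close>

lemma vertices_one_True:
  assumes "\<And>i. 1 \<le> i \<Longrightarrow> i \<le> m \<Longrightarrow> u i \<noteq> 1 \<Longrightarrow> True \<notin> set (W i)"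
  shows "0 # map (nth (walk True 0 (whole W m))) (cut_vertices m u (wcut m W) 1)
    = walk True 0 (ones u W m)"
proof -
  have "map (nth (walk True 0 (whole W m))) (cut_vertices m u (wcut m W) 1)
      = joined (\<lambda>i. u i = 1) (\<lambda>i. walk True (\<Sum>j\<in>{1..i - 1}. count_list (W j) True) (W i)) m"
    unfolding cut_vertices_joined map_joined by (rule joined_cong) (rule walk_interval)
  moreover have "0 # joined (\<lambda>i. u i = 1) (\<lambda>i. walk True (\<Sum>j\<in>{1..i - 1}. count_list (W j) True) (W i)) m
      = walk True 0 (ones u W m)"
    using assms
  proof (induction m)
    case (Suc m)
    have "count_list (ones u W m) True = (\<Sum>j\<in>{1..m}. count_list (W j) True)"
      unfolding count_list_joined by (rule sum.cong) (use Suc.prems in \<open>auto simp: count_list_0_iff\<close>)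
    with Suc show ?case by (simp add: walk_append)
  qed simp
  ultimately show ?thesis by simp
qed

text \<open>The bound \<open>m\<close> of the concatenation is kept apart from the number
  \<open>n\<close> of intervals because \<open>vertices_one_False\<close> uses initial parts of a
  fixed cut.\<close>

lemma length_joined_intervals:
  assumes "m \<le> n"
  shows "length (joined S (\<lambda>i. [psums n a ! (i - 1)..<Suc (psums n a ! i)]) m)
    = (\<Sum>i\<in>{1..m}. if S i then Suc (a i) else 0)"
  unfolding length_joined
proof (rule sum.cong)
  fix i assume "i \<in> {1..m}"
  then have "psums n a ! i - psums n a ! (i - 1) = a i" "psums n a ! (i - 1) \<le> psums n a ! i"
    using psums_diff[of i n] cuts_mono[OF psums_cuts, of "i - 1" i n] assms by auto
  then show "(if S i then length [psums n a ! (i - 1)..<Suc (psums n a ! i)] else 0) =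
      (if S i then Suc (a i) else 0)" by (simp add: Suc_diff_le)
qed simp

lemma length_cut_vertices:
  "length (cut_vertices m u (psums m a) s) = (\<Sum>i\<in>{1..m}. if u i = s then Suc (a i) else 0)"
  unfolding cut_vertices_joined by (rule length_joined_intervals) simp

text \<open>By comparison with \<open>length_cut_vertices\<close>, \<open>ones\<close> has one
  letter \<open>False\<close> for each vertex in the value \<open>1\<close> part of the image cut;
  without the first letter there is one for each step.\<close>

lemma count_ones:
  "count_list (ones u W m) False = (\<Sum>i\<in>{1..m}. if u i = 1 then Suc (count_list (W i) False) else 0)"
  unfolding count_list_joined by (rule sum.cong) auto

text \<open>The dummy vertex \<open>d\<close> corresponds to the superfluous first letter of \<open>ones\<close>.\<close>

lemma vertices_one_False:
  "d # map (nth (walk False 0 (whole W m))) (cut_vertices m u (wcut m W) 1)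
    = map (nth (d # cut_vertices m u (fcut m W) 1)) (walk False 0 (ones u W m))"
proof -
  have 1: "map (nth (walk False 0 (whole W m))) (cut_vertices m u (wcut m W) 1)
      = joined (\<lambda>i. u i = 1) (\<lambda>i. walk False (\<Sum>j\<in>{1..i - 1}. count_list (W j) False) (W i)) m"
    unfolding cut_vertices_joined map_joined by (rule joined_cong) (rule walk_interval)
  \<comment> \<open>The induction runs over the number \<open>n\<close> of intervals used, while the
    cut into all \<open>m\<close> intervals stays fixed.\<close>
  have "d # joined (\<lambda>i. u i = 1) (\<lambda>i. walk False (\<Sum>j\<in>{1..i - 1}. count_list (W j) False) (W i)) n
    = map (nth (d # joined (\<lambda>i. u i = 1) (\<lambda>i. [fcut m W ! (i - 1)..<Suc (fcut m W ! i)]) n))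
        (walk False 0 (ones u W n))" if "n \<le> m" for n
    using that
  proof (induction n)
    case (Suc n)
    show ?case
    proof (cases "u (Suc n) = 1")
      case True
      let ?V = "joined (\<lambda>i. u i = 1) (\<lambda>i. [fcut m W ! (i - 1)..<Suc (fcut m W ! i)]) n"
      let ?I = "[fcut m W ! n..<Suc (fcut m W ! Suc n)]"
      have len: "length ?V = count_list (ones u W n) False"
        unfolding count_ones by (rule length_joined_intervals) (use Suc.prems in simp)
      have I: "fcut m W ! Suc n = fcut m W ! n + count_list (W (Suc n)) False"
        using Suc.prems by (simp add: psums_nth)
      have "map (nth (d # ?V @ ?I)) (walk False 0 (ones u W n)) = map (nth (d # ?V)) (walk False 0 (ones u W n))"
      proof (rule map_cong)
        fix x assume "x \<in> set (walk False 0 (ones u W n))"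
        then have "x \<le> length ?V" unfolding set_walk len by simp
        then show "(d # ?V @ ?I) ! x = (d # ?V) ! x"
          by (cases x) (auto simp: nth_append simp del: upt_Suc)
      qed simp
      \<comment> \<open>The letter \<open>False\<close> of the jump leads to index
        \<open>Suc (length ?V)\<close>, which is the first vertex of the new interval.\<close>
      moreover have "map (nth (d # ?V @ ?I)) (walk False (Suc (length ?V) + 0) (W (Suc n)))
          = walk False (fcut m W ! n + 0) (W (Suc n))"
        unfolding walk_shift[of _ _ 0]
        by (auto simp: set_walk I nth_append simp del: upt_Suc)
      ultimately show ?thesis using Suc True len
        by (simp add: walk_append psums_nth del: upt_Suc)
    qed (use Suc in simp)
  qed simp
  from this[of m] show ?thesis unfolding 1 unfolding cut_vertices_joined by simp
qed

section \<open>Two ways of indexing by families of pieces\<close>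

text \<open>The condition outside \<open>{1..m}\<close> makes \<open>W\<close> determined by the pieces of the word.\<close>

definition families :: "nat \<Rightarrow> nat \<Rightarrow> nat \<Rightarrow> (nat \<Rightarrow> bool list) set" where
  "families m p q = {W. (\<forall>i. i \<notin> {1..m} \<longrightarrow> W i = []) \<and> whole W m \<in> words p q}"

definition good_families :: "nat \<Rightarrow> (nat \<Rightarrow> nat) \<Rightarrow> nat \<Rightarrow> nat \<Rightarrow> (nat \<Rightarrow> bool list) set" where
  "good_families m u p q = {W \<in> families m p q. \<forall>i\<in>{1..m}. u i \<noteq> 1 \<longrightarrow> True \<notin> set (W i)}"

lemma psums_cong: "(\<And>i. 1 \<le> i \<Longrightarrow> i \<le> m \<Longrightarrow> a i = b i) \<Longrightarrow> psums m a = psums m b"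
  by (auto simp: psums_def simp del: upt_Suc intro!: sum.cong)

lemma psums_inj: "psums m a = psums m b \<Longrightarrow> 1 \<le> i \<Longrightarrow> i \<le> m \<Longrightarrow> a i = b i"
  using psums_diff by metis

lemma families_length:
  assumes "W \<in> families m p q"
  shows "(\<Sum>i\<in>{1..m}. length (W i)) = p + q"
    "(\<Sum>i\<in>{1..m}. count_list (W i) True) = p"
    "(\<Sum>i\<in>{1..m}. count_list (W i) False) = q"
proof -
  have w: "whole W m \<in> words p q" using assms by (simp add: families_def)
  then show "(\<Sum>i\<in>{1..m}. count_list (W i) True) = p" "(\<Sum>i\<in>{1..m}. count_list (W i) False) = q"
    by (simp_all add: words_def count_list_joined)
  with count_list_length[of "whole W m"] w show "(\<Sum>i\<in>{1..m}. length (W i)) = p + q"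
    by (simp add: words_def length_joined)
qed

lemma whole_inj:
  assumes "whole W m = whole V m" "\<And>i. 1 \<le> i \<Longrightarrow> i \<le> m \<Longrightarrow> length (W i) = length (V i)"
    "1 \<le> i" "i \<le> m"
  shows "W i = V i"
  using assms
proof (induction m)
  case (Suc m)
  have "whole W m = whole V m \<and> W (Suc m) = V (Suc m)"
    using Suc.prems by (simp add: append_eq_append_conv)
  with Suc show ?case by (auto simp: le_Suc_eq)
qed simp

text \<open>A word with a cut of its vertices amounts to the list of its pieces. This turns the
  double sum of the first composite into a single one.\<close>

lemma bij_families:
  "bij_betw (\<lambda>W. (whole W m, wcut m W)) (families m p q) (words p q \<times> cuts m (p + q))"
proof (rule bij_betwI')
  fix V W assume "V \<in> families m p q" "W \<in> families m p q"
  then have "V i = W i" if "whole V m = whole W m" "wcut m V = wcut m W" for i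
    using whole_inj[OF that(1), of i] psums_inj[OF that(2)]
    by (cases "i \<in> {1..m}") (auto simp: families_def)
  then show "((whole V m, wcut m V) = (whole W m, wcut m W)) = (V = W)" by auto
next
  fix W assume W: "W \<in> families m p q"
  then show "(whole W m, wcut m W) \<in> words p q \<times> cuts m (p + q)"
    using psums_cuts[of m "\<lambda>i. length (W i)"] families_length(1)[OF W] by (simp add: families_def)
next
  fix z assume "z \<in> words p q \<times> cuts m (p + q)"
  then obtain w P where z: "z = (w, P)" and w: "w \<in> words p q" and P: "P \<in> cuts m (p + q)"
    by (cases z) auto
  define W where "W i = (if i \<in> {1..m} then take (P ! i - P ! (i - 1)) (drop (P ! (i - 1)) w) else [])" for i
  have len: "length w = p + q" using w count_list_length[of w] by (simp add: words_def)
  have "whole W j = take (P ! j) w" if "j \<le> m" for j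
    using that
  proof (induction j)
    case 0
    then show ?case using P by (simp add: cuts_def)
  next
    case (Suc j)
    then have "whole W (Suc j) = take (P ! j + (P ! Suc j - P ! j)) w"
      unfolding take_add by (simp add: W_def[of "Suc j"])
    then show ?case using cuts_mono[OF P, of j "Suc j"] Suc.prems by simp
  qed
  from this[of m] have whole: "whole W m = w" using P len by (simp add: cuts_def)
  have "wcut m W = psums m (\<lambda>j. P ! j - P ! (j - 1))"
  proof (rule psums_cong)
    fix i assume i: "1 \<le> i" "i \<le> m"
    have "P ! i \<le> p + q" using cuts_mono[OF P, of i m] i P by (simp add: cuts_def)
    then show "length (W i) = P ! i - P ! (i - 1)" using i by (simp add: W_def len)
  qed
  then have "wcut m W = P" using cuts_psums[OF P] by simp
  moreover have "W \<in> families m p q" using w by (simp add: families_def whole) (simp add: W_def)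
  ultimately show "\<exists>W\<in>families m p q. z = (whole W m, wcut m W)" using z whole by auto
qed

lemma finite_families: "finite (families m p q)"
  using bij_betw_finite[OF bij_families] by (simp add: finite_words finite_cuts)

text \<open>The letter singled out has \<open>a\<close> letters \<open>False\<close> after it. In
  \<open>ones_surj\<close> it is the jump into the last interval.\<close>

lemma split_at_False:
  "count_list w False = s + Suc a \<Longrightarrow>
    \<exists>v t. w = v @ False # t \<and> count_list v False = s \<and> count_list t False = a"
proof (induction w arbitrary: s)
  case (Cons c w)
  show ?case
  proof (cases "c = False \<and> s = 0")
    case True
    then show ?thesis using Cons.prems by (intro exI[of _ "[]"] exI[of _ w]) auto
  next
    case False
    then have "count_list w False = (if c then s else s - 1) + Suc a" using Cons.prems by auto
    from Cons.IH[OF this] obtain v t where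
      "w = v @ False # t" "count_list v False = (if c then s else s - 1)" "count_list t False = a" by blast
    then show ?thesis using False by (intro exI[of _ "c # v"] exI[of _ t]) auto
  qed
qed simp

text \<open>If the marked letters were at different places, one tail would contain the other marked
  letter and its whole tail, hence more letters \<open>False\<close>.\<close>

lemma split_at_False_unique:
  "v @ False # t = v' @ False # t' \<Longrightarrow> count_list t False = count_list t' False \<Longrightarrow> v = v' \<and> t = t'"
  by (auto simp: append_eq_append_conv2 Cons_eq_append_conv append_eq_Cons_conv)

text \<open>The pieces are read off from the end. The number of letters \<open>False\<close> locates
  the start of a piece with value \<open>1\<close>, and any other piece consists of letters
  \<open>False\<close> only.\<close>

lemma ones_inj:
  assumes "ones u W m = ones u V m"
    "\<And>i. 1 \<le> i \<Longrightarrow> i \<le> m \<Longrightarrow> count_list (W i) False = count_list (V i) False"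
    "\<And>i. 1 \<le> i \<Longrightarrow> i \<le> m \<Longrightarrow> u i \<noteq> 1 \<Longrightarrow> True \<notin> set (W i) \<and> True \<notin> set (V i)"
    "1 \<le> i" "i \<le> m"
  shows "W i = V i"
  using assms
proof (induction m)
  case (Suc m)
  have "ones u W m = ones u V m \<and> W (Suc m) = V (Suc m)"
  proof (cases "u (Suc m) = 1")
    case True
    then show ?thesis using Suc.prems(1) Suc.prems(2)[of "Suc m"]
      by (intro split_at_False_unique) auto
  next
    case False
    then have "W (Suc m) = V (Suc m)"
      using Suc.prems(2,3)[of "Suc m"] replicate_of_count[of "W (Suc m)"] replicate_of_count[of "V (Suc m)"]
      by simp
    then show ?thesis using False Suc.prems(1) by simp
  qed
  with Suc show ?case by (auto simp: le_Suc_eq)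
qed simp

text \<open>Pieces are split off from the end as in \<open>ones_inj\<close>. A leading
  \<open>True\<close> would precede the first jump and belong to no piece; without it nothing is
  left over at \<open>m = 0\<close>.\<close>

lemma ones_surj:
  assumes "w = [] \<or> \<not> hd w" "count_list w False = (\<Sum>i\<in>{1..m}. if u i = 1 then Suc (a i) else 0)"
  shows "\<exists>W. (\<forall>i\<in>{1..m}. count_list (W i) False = a i \<and> (u i \<noteq> 1 \<longrightarrow> True \<notin> set (W i)))
    \<and> ones u W m = w"
  using assms
proof (induction m arbitrary: w)
  case 0
  then show ?case by (cases w) auto
next
  case (Suc m)
  have *: "ones u (W(Suc m := t)) m = ones u W m" for W t by (rule joined_cong) simp
  show ?case
  proof (cases "u (Suc m) = 1")
    case True
    then have "count_list w False = (\<Sum>i\<in>{1..m}. if u i = 1 then Suc (a i) else 0) + Suc (a (Suc m))"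
      using Suc.prems by simp
    from split_at_False[OF this] obtain v t where w: "w = v @ False # t"
      and v: "count_list v False = (\<Sum>i\<in>{1..m}. if u i = 1 then Suc (a i) else 0)"
      and t: "count_list t False = a (Suc m)" by blast
    have "v = [] \<or> \<not> hd v" using Suc.prems(1) w by (cases v) auto
    from Suc.IH[OF this v] obtain W where
      "\<forall>i\<in>{1..m}. count_list (W i) False = a i \<and> (u i \<noteq> 1 \<longrightarrow> True \<notin> set (W i))" "ones u W m = v"
      by blast
    then show ?thesis using * True w t
      by (intro exI[of _ "W(Suc m := t)"]) (auto simp: atLeastAtMostSuc_conv)
  next
    case False
    then have "count_list w False = (\<Sum>i\<in>{1..m}. if u i = 1 then Suc (a i) else 0)"
      using Suc.prems by simp
    from Suc.IH[OF Suc.prems(1) this] obtain W where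
      "\<forall>i\<in>{1..m}. count_list (W i) False = a i \<and> (u i \<noteq> 1 \<longrightarrow> True \<notin> set (W i))" "ones u W m = w"
      by blast
    moreover have "count_list (replicate n False) False = n" for n by (induction n) auto
    ultimately show ?thesis using * False
      by (intro exI[of _ "W(Suc m := replicate (a (Suc m)) False)"]) (auto simp: atLeastAtMostSuc_conv)
  qed
qed

lemma hd_ones: "ones u W m = [] \<or> \<not> hd (ones u W m)"
  by (induction m) (auto simp: hd_append)

lemma ones_Cons:
  assumes "\<exists>i\<in>{1..m}. u i = 1"
  shows "ones u W m = False # tl (ones u W m)"
proof -
  have "ones u W m \<noteq> []" using assms by (auto simp: joined_empty_iff)
  with hd_ones[of u W m] show ?thesis by (cases "ones u W m") auto
qed

lemma count_ones_True:
  assumes "\<And>i. 1 \<le> i \<Longrightarrow> i \<le> m \<Longrightarrow> u i \<noteq> 1 \<Longrightarrow> True \<notin> set (W i)"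
  shows "count_list (ones u W m) True = (\<Sum>j\<in>{1..m}. count_list (W j) True)"
  unfolding count_list_joined by (rule sum.cong) (use assms in \<open>auto simp: count_list_0_iff\<close>)

text \<open>The target indexes the second composite: a cut \<open>Q\<close> of \<open>[q]\<close>,
  and a shuffle of \<open>[p]\<close> with the value \<open>1\<close> part of \<open>Q\<close>,
  whose dimension depends on \<open>Q\<close>. Conversely, the interval lengths of \<open>Q\<close>
  prescribe the letters \<open>False\<close> in the pieces, and \<open>ones_surj\<close> divides the
  word accordingly.\<close>

lemma bij_good_families:
  assumes "\<exists>i\<in>{1..m}. u i = 1"
  shows "bij_betw (\<lambda>W. (fcut m W, tl (ones u W m))) (good_families m u p q)
    (SIGMA Q:cuts m q. words p (length (cut_vertices m u Q 1) - 1))"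
proof (rule bij_betwI')
  fix V W assume VW: "V \<in> good_families m u p q" "W \<in> good_families m u p q"
  have "V i = W i" if "tl (ones u V m) = tl (ones u W m)" "fcut m V = fcut m W" for i
  proof -
    have "ones u V m = ones u W m" using ones_Cons[OF assms, of V] ones_Cons[OF assms, of W] that by metis
    from ones_inj[OF this, of i] psums_inj[OF that(2)] VW show ?thesis
      by (cases "i \<in> {1..m}") (auto simp: good_families_def families_def)
  qed
  then show "((fcut m V, tl (ones u V m)) = (fcut m W, tl (ones u W m))) = (V = W)" by auto
next
  fix W assume W: "W \<in> good_families m u p q"
  then have W': "W \<in> families m p q" by (simp add: good_families_def)
  have "count_list (ones u W m) True = p"
    using count_ones_True[of m u W] W families_length(2)[OF W'] by (auto simp: good_families_def)
  moreover have "count_list (ones u W m) False = length (cut_vertices m u (fcut m W) 1)"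
    by (simp only: count_ones length_cut_vertices)
  ultimately have "tl (ones u W m) \<in> words p (length (cut_vertices m u (fcut m W) 1) - 1)"
    using ones_Cons[OF assms, of W] unfolding words_def
    by (cases "ones u W m") auto
  then show "(fcut m W, tl (ones u W m)) \<in> (SIGMA Q:cuts m q. words p (length (cut_vertices m u Q 1) - 1))"
    using psums_cuts[of m "\<lambda>i. count_list (W i) False"] families_length(3)[OF W'] by simp
next
  fix z assume "z \<in> (SIGMA Q:cuts m q. words p (length (cut_vertices m u Q 1) - 1))"
  then obtain Q w where z: "z = (Q, w)" and Q: "Q \<in> cuts m q"
    and w: "w \<in> words p (length (cut_vertices m u Q 1) - 1)" by auto
  define a where "a i = Q ! i - Q ! (i - 1)" for i
  have Qa: "Q = psums m a" using cuts_psums[OF Q] unfolding a_def .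
  have len: "length (cut_vertices m u Q 1) = (\<Sum>i\<in>{1..m}. if u i = 1 then Suc (a i) else 0)"
    unfolding Qa by (rule length_cut_vertices)
  obtain i where "i \<in> {1..m}" "u i = 1" using assms by blast
  then have "length (cut_vertices m u Q 1) \<ge> 1"
    unfolding len by (intro order.trans[OF _ member_le_sum[of i]]) auto
  \<comment> \<open>The word \<open>w\<close> has one letter \<open>False\<close> per step;
    restoring the first letter gives one per vertex. Since there is a vertex, the truncated
    subtraction is exact.\<close>
  then have "count_list (False # w) False = (\<Sum>i\<in>{1..m}. if u i = 1 then Suc (a i) else 0)"
    using w len by (simp add: words_def)
  from ones_surj[OF _ this] obtain V where
    V: "\<forall>i\<in>{1..m}. count_list (V i) False = a i \<and> (u i \<noteq> 1 \<longrightarrow> True \<notin> set (V i))" "ones u V m = False # w"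
    by auto
  define W where "W i = (if i \<in> {1..m} then V i else [])" for i
  have "ones u W m = ones u V m" by (rule joined_cong) (simp add: W_def)
  then have ones: "ones u W m = False # w" using V by simp
  have "fcut m W = psums m a" by (rule psums_cong) (use V in \<open>simp add: W_def\<close>)
  then have fcut: "fcut m W = Q" using Qa by simp
  have "True \<notin> set (W i)" if "1 \<le> i" "i \<le> m" "u i \<noteq> 1" for i
    using V(1) that by (simp add: W_def)
  then have "(\<Sum>i\<in>{1..m}. count_list (W i) True) = count_list (ones u W m) True"
    using count_ones_True[of m u W] by simp
  then have "(\<Sum>i\<in>{1..m}. count_list (W i) True) = p"
    using w unfolding ones by (simp add: words_def)
  moreover have "(\<Sum>i\<in>{1..m}. count_list (W i) False) = q"
    using psums_nth[of m m "\<lambda>i. count_list (W i) False"] fcut Q by (simp add: cuts_def)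
  ultimately have "W \<in> good_families m u p q"
    using V(1) by (auto simp: good_families_def families_def words_def count_list_joined W_def)
  then show "\<exists>W\<in>good_families m u p q. z = (fcut m W, tl (ones u W m))"
    using z fcut ones by auto
qed

section \<open>Signs\<close>

lemma inversions_0: "True \<notin> set w \<Longrightarrow> inversions w = 0"
  by (induction w) (auto simp: count_list_0_iff)

text \<open>Compare the letters \<open>False\<close> before a letter \<open>True\<close> of
  \<open>W j\<close>. In \<open>ones\<close> there is an additional one for each interval with value
  \<open>1\<close> up to and including the \<open>j\<close>-th, while those of earlier intervals
  with other values are missing. The two corrections are on opposite sides to avoid
  subtraction.\<close>

lemma inversions_whole:
  assumes "\<And>i. 1 \<le> i \<Longrightarrow> i \<le> m \<Longrightarrow> u i \<noteq> 1 \<Longrightarrow> True \<notin> set (W i)"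
  shows "inversions (whole W m) + (\<Sum>j\<in>{1..m}. card {i\<in>{1..j}. u i = 1} * count_list (W j) True)
    = inversions (ones u W m)
      + (\<Sum>j\<in>{1..m}. (\<Sum>i\<in>{1..<j}. if u i = 1 then 0 else count_list (W i) False) * count_list (W j) True)"
  using assms
proof (induction m)
  case (Suc m)
  let ?A = "\<lambda>i. count_list (W i) False"
  let ?x = "count_list (W (Suc m)) True"
  note IH = Suc.IH[OF Suc.prems, simplified]
  show ?case
  proof (cases "u (Suc m) = 1")
    case False
    then have "True \<notin> set (W (Suc m))" using Suc.prems by simp
    then have "?x = 0" "inversions (W (Suc m)) = 0" by (simp_all add: count_list_0_iff inversions_0)
    then show ?thesis using IH False by (simp add: inversions_append)
  next
    case True
    have "card {i\<in>{1..Suc m}. u i = 1} = (\<Sum>i\<in>{1..Suc m}. if u i = 1 then 1 else 0)"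
      unfolding card_eq_sum by (rule sum.inter_filter) simp
    then have c: "card {i\<in>{1..Suc m}. u i = 1} = Suc (\<Sum>i\<in>{1..m}. if u i = 1 then 1 else 0)"
      using True by simp
    have "(\<Sum>i\<in>{1..m}. ?A i) + (\<Sum>i\<in>{1..m}. if u i = 1 then 1 else 0) =
        (\<Sum>i\<in>{1..m}. if u i = 1 then Suc (?A i) else 0) + (\<Sum>i\<in>{1..m}. if u i = 1 then 0 else ?A i)"
      unfolding sum.distrib[symmetric] by (rule sum.cong) auto
    then have "count_list (whole W m) False + card {i\<in>{1..Suc m}. u i = 1} =
        Suc (count_list (ones u W m) False) + (\<Sum>i\<in>{1..<Suc m}. if u i = 1 then 0 else ?A i)"
      unfolding c count_ones by (simp add: count_list_joined atLeastLessThanSuc_atLeastAtMost)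
    then have "count_list (whole W m) False * ?x + card {i\<in>{1..Suc m}. u i = 1} * ?x =
        ?x + count_list (ones u W m) False * ?x + (\<Sum>i\<in>{1..<Suc m}. if u i = 1 then 0 else ?A i) * ?x"
      by (metis add_mult_distrib mult_Suc)
    then show ?thesis using IH True by (simp add: inversions_append)
  qed
qed simp

text \<open>Here \<open>L i\<close> is the length in the image cut and \<open>x i\<close> the number
  of steps of \<lambda>. An inverted pair has \<open>u i > u j \<ge> 1\<close>, so the earlier
  interval contains no step of \<lambda>, and only \<open>a i * x j\<close> is added.\<close>

lemma perm_exponent:
  fixes a x :: "nat \<Rightarrow> nat"
  assumes "\<And>i. 1 \<le> i \<Longrightarrow> i \<le> m \<Longrightarrow> u i \<noteq> 1 \<Longrightarrow> x i = 0 \<and> L i = a i"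
    and u: "\<And>i. 1 \<le> i \<Longrightarrow> i \<le> m \<Longrightarrow> u i \<ge> (1::nat)"
  shows "(\<Sum>(i, j)\<in>{(i, j). 1 \<le> i \<and> i < j \<and> j \<le> m \<and> u i > u j}. (L i + x i) * (L j + x j)) =
    (\<Sum>(i, j)\<in>{(i, j). 1 \<le> i \<and> i < j \<and> j \<le> m \<and> u i > u j}. L i * L j)
    + (\<Sum>j\<in>{1..m}. (\<Sum>i\<in>{1..<j}. if u i = 1 then 0 else a i) * x j)"
proof -
  let ?P = "{(i, j). 1 \<le> i \<and> i < j \<and> j \<le> m \<and> u i > u j}"
  let ?T = "{(i, j). 1 \<le> i \<and> i < j \<and> j \<le> m}"
  have fin: "finite ?T" by (rule finite_subset[of _ "{1..m} \<times> {1..m}"]) auto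
  have ne1: "u i \<noteq> 1" if "(i, j) \<in> ?P" for i j
    using that u[of j] by auto
  have "(\<Sum>(i, j)\<in>?P. (L i + x i) * (L j + x j)) = (\<Sum>(i, j)\<in>?P. L i * L j + a i * x j)"
  proof (rule sum.cong)
    fix z assume "z \<in> ?P"
    moreover obtain i j where "z = (i, j)" by (cases z)
    ultimately show "(case z of (i, j) \<Rightarrow> (L i + x i) * (L j + x j)) = (case z of (i, j) \<Rightarrow> L i * L j + a i * x j)"
      using ne1[of i j] assms(1)[of i] by (auto simp: algebra_simps)
  qed simp
  also have "\<dots> = (\<Sum>(i, j)\<in>?P. L i * L j) + (\<Sum>(i, j)\<in>?P. a i * x j)"
    by (simp add: case_prod_unfold sum.distrib)
  \<comment> \<open>The sum is extended to all pairs \<open>i < j\<close>. A new pair has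
    \<open>u i \<le> u j\<close>, so either \<open>u i = 1\<close>, or \<open>u j\<close> exceeds
    \<open>1\<close> and \<open>x j = 0\<close>.\<close>
  also have "(\<Sum>(i, j)\<in>?P. a i * x j) = (\<Sum>(i, j)\<in>?T. (if u i = 1 then 0 else a i) * x j)"
  proof (rule sum.mono_neutral_cong_left)
    have zero: "(if u i = 1 then 0 else a i) * x j = 0" if "(i, j) \<in> ?T - ?P" for i j
    proof (cases "u i = 1")
      case False
      then have "u j \<noteq> 1" using that u[of i] by auto
      then have "x j = 0" using that assms(1)[of j] by auto
      then show ?thesis by simp
    qed simp
    show "\<forall>z\<in>?T - ?P. (case z of (i, j) \<Rightarrow> (if u i = 1 then 0 else a i) * x j) = 0"
    proof
      fix z assume "z \<in> ?T - ?P"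
      with zero[of "fst z" "snd z"] show "(case z of (i, j) \<Rightarrow> (if u i = 1 then 0 else a i) * x j) = 0"
        unfolding case_prod_unfold prod.collapse by blast
    qed
    show "(case z of (i, j) \<Rightarrow> a i * x j) = (case z of (i, j) \<Rightarrow> (if u i = 1 then 0 else a i) * x j)"
      if "z \<in> ?P" for z using that ne1 by (cases z) auto
  qed (use fin in auto)
  also have "\<dots> = (\<Sum>(j, i)\<in>(SIGMA j:{1..m}. {1..<j}). (if u i = 1 then 0 else a i) * x j)"
    by (rule sum.reindex_bij_witness[of _ "\<lambda>(j, i). (i, j)" "\<lambda>(i, j). (j, i)"]) auto
  also have "\<dots> = (\<Sum>j\<in>{1..m}. (\<Sum>i\<in>{1..<j}. if u i = 1 then 0 else a i) * x j)"
    by (simp add: sum.Sigma[symmetric] sum_distrib_right)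
  finally show ?thesis .
qed

section \<open>Inner intervals and the position sign\<close>

text \<open>Each of the \<open>l\<close> values other than \<open>1\<close> is taken exactly once,
  which leaves \<open>k + 1\<close> of the \<open>k + l + 1\<close> intervals.\<close>

lemma card_ones:
  assumes "one_biased k (l + 1) u"
  shows "card {i\<in>{1..k + (l + 1)}. u i = 1} = Suc k"
proof -
  let ?M = "{1..k + (l + 1)}"
  let ?O = "{i\<in>?M. u i = 1}"
  have img: "u ` ?M = {1..l + 1}" using assms by (simp add: one_biased_def nondeg_surj_def)
  have "inj_on u (?M - ?O)"
    using assms unfolding one_biased_def by (intro inj_onI) blast
  then have "card (?M - ?O) = card (u ` (?M - ?O))" by (simp add: card_image)
  moreover have "u ` (?M - ?O) = {1..l + 1} - {1}" unfolding img[symmetric] by auto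
  ultimately have "card (?M - ?O) = l" by simp
  moreover have "card (?M - ?O) = card ?M - card ?O" by (rule card_Diff_subset) auto
  moreover have "card ?O \<le> card ?M" by (rule card_mono) auto
  ultimately show ?thesis by simp
qed

text \<open>The inner intervals are those with value \<open>1\<close> except the last one, so there
  are \<open>k\<close> of them. Those before \<open>j\<close> are counted by the first term, which
  also counts \<open>j\<close> itself.\<close>

lemma card_inner:
  fixes u :: "nat \<Rightarrow> nat"
  assumes ob: "one_biased k (l + 1) u" and m: "m = k + (l + 1)" and j: "j \<in> {1..m}" "u j = 1"
  shows "card {i\<in>{1..j}. u i = 1} + card {i\<in>{1..m}. \<not> final_interval m u i \<and> j \<le> i} = Suc k"
proof -
  let ?O = "{i\<in>{1..m}. u i = 1}"
  let ?I = "{i\<in>{1..m}. \<not> final_interval m u i}"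
  have inner: "u i = 1 \<and> (\<exists>i'\<in>?O. i < i')" if i: "i \<in> ?I" for i
  proof -
    obtain i' where "i < i'" "i' \<le> m" "u i' = u i" using i by (auto simp: final_interval_def)
    moreover from this have "u i = 1"
      using ob i unfolding one_biased_def m[symmetric] by (metis (no_types, lifting) atLeastAtMost_iff mem_Collect_eq order.trans less_imp_le less_irrefl)
    ultimately show ?thesis using i by (intro conjI bexI[of _ i']) auto
  qed
  have finO: "finite ?O" by simp
  have "?O \<noteq> {}" using j by auto
  then have M: "Max ?O \<in> ?O" "\<And>i. i \<in> ?O \<Longrightarrow> i \<le> Max ?O" using Max_in[OF finO] Max_ge[OF finO] by auto
  have "?I = ?O - {Max ?O}"
  proof (intro equalityI subsetI)
    fix i assume "i \<in> ?I"
    with inner obtain i' where "u i = 1" "i' \<in> ?O" "i < i'" by blast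
    with M(2)[of i'] have "i \<noteq> Max ?O" by linarith
    with \<open>i \<in> ?I\<close> \<open>u i = 1\<close> show "i \<in> ?O - {Max ?O}" by blast
  next
    fix i assume i: "i \<in> ?O - {Max ?O}"
    with M have "i < Max ?O" by (simp add: order.strict_iff_order)
    with M(1) i show "i \<in> ?I" by (auto simp: final_interval_def)
  qed
  with M(1) card_ones[OF ob] have cI: "card ?I = k" by (simp add: m)
  have "{i\<in>{1..j}. u i = 1} = insert j {i\<in>{1..<j}. u i = 1}" using j by auto
  then have c: "card {i\<in>{1..j}. u i = 1} = Suc (card {i\<in>{1..<j}. u i = 1})" by simp
  have "?I = {i\<in>{1..<j}. u i = 1} \<union> {i\<in>{1..m}. \<not> final_interval m u i \<and> j \<le> i}"
  proof (intro equalityI subsetI)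
    fix i assume "i \<in> ?I"
    with inner[of i] show "i \<in> {i\<in>{1..<j}. u i = 1} \<union> {i\<in>{1..m}. \<not> final_interval m u i \<and> j \<le> i}" by auto
  next
    fix i assume "i \<in> {i\<in>{1..<j}. u i = 1} \<union> {i\<in>{1..m}. \<not> final_interval m u i \<and> j \<le> i}"
    with j show "i \<in> ?I" by (auto simp: final_interval_def)
  qed
  moreover have "card ({i\<in>{1..<j}. u i = 1} \<union> {i\<in>{1..m}. \<not> final_interval m u i \<and> j \<le> i}) =
      card {i\<in>{1..<j}. u i = 1} + card {i\<in>{1..m}. \<not> final_interval m u i \<and> j \<le> i}"
    by (rule card_Un_disjoint) auto
  ultimately show ?thesis using c cI by simp
qed

text \<open>A step of \<lambda> in interval \<open>j\<close> raises the endpoint of every inner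
  interval from the \<open>j\<close>-th on. Together with the jumps up to \<open>j\<close> this
  counts each step \<open>k + 1\<close> times, by \<open>card_inner\<close>.\<close>

lemma pos_exponent:
  assumes "one_biased k (l + 1) u" and m: "m = k + (l + 1)"
    and x: "\<And>i. 1 \<le> i \<Longrightarrow> i \<le> m \<Longrightarrow> u i \<noteq> 1 \<Longrightarrow> x i = 0"
  shows "(\<Sum>j\<in>{1..m}. card {i\<in>{1..j}. u i = 1} * x j)
    + (\<Sum>i\<in>{i\<in>{1..m}. \<not> final_interval m u i}. \<Sum>j\<in>{1..i}. x j) = Suc k * (\<Sum>j\<in>{1..m}. x j)"
proof -
  let ?I = "{i\<in>{1..m}. \<not> final_interval m u i}"
  have "(\<Sum>i\<in>?I. \<Sum>j\<in>{1..i}. x j) = (\<Sum>i\<in>?I. \<Sum>j\<in>{j\<in>{1..m}. j \<le> i}. x j)"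
    by (intro sum.cong) auto
  also have "\<dots> = (\<Sum>j\<in>{1..m}. \<Sum>i\<in>{i\<in>?I. j \<le> i}. x j)"
    by (rule sum.swap_restrict) auto
  also have "\<dots> = (\<Sum>j\<in>{1..m}. card {i\<in>{1..m}. \<not> final_interval m u i \<and> j \<le> i} * x j)"
    by (simp add: conj_assoc)
  finally have "(\<Sum>j\<in>{1..m}. card {i\<in>{1..j}. u i = 1} * x j) + (\<Sum>i\<in>?I. \<Sum>j\<in>{1..i}. x j)
      = (\<Sum>j\<in>{1..m}. (card {i\<in>{1..j}. u i = 1}
          + card {i\<in>{1..m}. \<not> final_interval m u i \<and> j \<le> i}) * x j)"
    by (simp add: sum.distrib add_mult_distrib)
  also have "\<dots> = (\<Sum>j\<in>{1..m}. Suc k * x j)"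
  proof (rule sum.cong)
    fix j assume "j \<in> {1..m}"
    then show "(card {i\<in>{1..j}. u i = 1} + card {i\<in>{1..m}. \<not> final_interval m u i \<and> j \<le> i}) * x j = Suc k * x j"
      using card_inner[OF assms(1) m, of j] x[of j] by (cases "u j = 1") auto
  qed simp
  finally show ?thesis by (simp add: sum_distrib_left)
qed

section \<open>Comparison of the total signs\<close>

lemma perm_sign_power:
  "perm_sign m u p = (- 1 :: 'k::{comm_ring,comm_monoid_mult}) ^
    (\<Sum>(i, j)\<in>{(i, j). 1 \<le> i \<and> i < j \<and> j \<le> m \<and> u i > u j}. interval_length m u p i * interval_length m u p j)"
  unfolding perm_sign_def power_sum by (simp add: case_prod_unfold)

lemma pos_sign_power:
  "pos_sign m u p = (- 1 :: 'k::{comm_ring,comm_monoid_mult}) ^ (\<Sum>i\<in>{i\<in>{1..m}. \<not> final_interval m u i}. p ! i)"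
  unfolding pos_sign_def power_sum ..

lemma one_biased_final:
  assumes "one_biased k (l + 1) u" "1 \<le> i" "i \<le> k + (l + 1)" "u i \<noteq> 1"
  shows "final_interval (k + (l + 1)) u i"
  unfolding final_interval_def
proof (intro allI impI notI)
  fix j assume j: "i < j \<and> j \<le> k + (l + 1)" "u j = u i"
  have "\<forall>i\<in>{1..k + (l + 1)}. \<forall>j\<in>{1..k + (l + 1)}. i \<noteq> j \<and> u i = u j \<longrightarrow> u i = 1"
    using assms(1) by (simp add: one_biased_def)
  from this[rule_format, of i j] j assms(2-4) show False by simp
qed

lemma one_biased_range:
  assumes "one_biased k (l + 1) u" "1 \<le> i" "i \<le> k + (l + 1)"
  shows "1 \<le> u i \<and> u i \<le> l + 1"
proof -
  have "u i \<in> u ` {1..k + (l + 1)}" using assms by simp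
  then show ?thesis using assms(1) by (simp add: one_biased_def nondeg_surj_def)
qed

lemma one_biased_ex:
  assumes "one_biased k (l + 1) u" "1 \<le> s" "s \<le> l + 1"
  shows "\<exists>i\<in>{1..k + (l + 1)}. u i = s"
proof -
  have "s \<in> u ` {1..k + (l + 1)}" using assms by (simp add: one_biased_def nondeg_surj_def)
  then show ?thesis by blast
qed

text \<open>The contribution \<open>D1\<close> of the steps of \<mu> outside the value
  \<open>1\<close> intervals enters both the inversions and the permutation sign, hence cancels. The
  jumps \<open>D2\<close> and the position part \<open>D3\<close> add up to
  \<open>(k + 1) * p\<close>, of which \<open>p\<close> is balanced by the first letter of
  \<open>ones\<close>.\<close>

lemma good_family_signs:
  assumes ob: "one_biased k (l + 1) u" and m: "m = k + (l + 1)" and W: "W \<in> good_families m u p q"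
  shows "(- 1 :: 'k::{comm_ring,comm_monoid_mult}) ^ inversions (whole W m)
      * (perm_sign m u (wcut m W) * pos_sign m u (wcut m W))
    = (- 1) ^ (k * p) * (perm_sign m u (fcut m W) * pos_sign m u (fcut m W)) * (- 1) ^ inversions (tl (ones u W m))"
proof -
  let ?P = "{(i, j). 1 \<le> i \<and> i < j \<and> j \<le> m \<and> u i > u j}"
  let ?I = "{i\<in>{1..m}. \<not> final_interval m u i}"
  let ?L = "interval_length m u (fcut m W)"
  define x a where "x i = count_list (W i) True" and "a i = count_list (W i) False" for i
  have fam: "W \<in> families m p q" and gd: "\<And>i. 1 \<le> i \<Longrightarrow> i \<le> m \<Longrightarrow> u i \<noteq> 1 \<Longrightarrow> True \<notin> set (W i)"
    using W by (auto simp: good_families_def)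
  have x0: "x i = 0" if "1 \<le> i" "i \<le> m" "u i \<noteq> 1" for i
    using gd[OF that] by (simp add: x_def count_list_0_iff)
  have sx: "(\<Sum>i\<in>{1..m}. x i) = p" using families_length(2)[OF fam] by (simp add: x_def)
  have L: "interval_length m u (wcut m W) i = ?L i + x i" if "1 \<le> i" "i \<le> m" for i
    using that by (simp add: interval_length_def psums_diff[simplified] x_def flip: count_list_length)
  have La: "?L i = a i" if "1 \<le> i" "i \<le> m" "u i \<noteq> 1" for i
    using that one_biased_final[OF ob, of i] by (simp add: interval_length_def psums_diff[simplified] a_def m)
  define D1 where "D1 = (\<Sum>j\<in>{1..m}. (\<Sum>i\<in>{1..<j}. if u i = 1 then 0 else a i) * x j)"
  define D2 where "D2 = (\<Sum>j\<in>{1..m}. card {i\<in>{1..j}. u i = 1} * x j)"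
  define D3 where "D3 = (\<Sum>i\<in>?I. \<Sum>j\<in>{1..i}. x j)"
  have ex: "\<exists>i\<in>{1..m}. u i = 1" using one_biased_ex[OF ob, of 1] m by simp
  have "inversions (ones u W m) = count_list (tl (ones u W m)) True + inversions (tl (ones u W m))"
    by (subst ones_Cons[OF ex]) simp
  moreover have "count_list (tl (ones u W m)) True = p"
    using count_ones_True[of m u W, OF gd] sx ones_Cons[OF ex, of W] by (cases "ones u W m") (auto simp: x_def)
  ultimately have 1: "inversions (whole W m) + D2 = inversions (tl (ones u W m)) + p + D1"
    using inversions_whole[of m u W, OF gd] unfolding D1_def D2_def x_def a_def by simp
  have "(\<Sum>(i, j)\<in>?P. interval_length m u (wcut m W) i * interval_length m u (wcut m W) j)
      = (\<Sum>(i, j)\<in>?P. (?L i + x i) * (?L j + x j))"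
    by (rule sum.cong) (auto simp: L)
  also have "\<dots> = (\<Sum>(i, j)\<in>?P. ?L i * ?L j) + D1"
    unfolding D1_def by (rule perm_exponent) (use x0 La one_biased_range[OF ob] m in auto)
  finally have 2: "(\<Sum>(i, j)\<in>?P. interval_length m u (wcut m W) i * interval_length m u (wcut m W) j)
      = (\<Sum>(i, j)\<in>?P. ?L i * ?L j) + D1" .
  have "(\<Sum>i\<in>?I. wcut m W ! i) = (\<Sum>i\<in>?I. fcut m W ! i + (\<Sum>j\<in>{1..i}. x j))"
    by (rule sum.cong) (auto simp: psums_nth x_def add.commute simp flip: sum.distrib count_list_length)
  then have 3: "(\<Sum>i\<in>?I. wcut m W ! i) = (\<Sum>i\<in>?I. fcut m W ! i) + D3"
    by (simp add: sum.distrib D3_def)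
  have 4: "D2 + D3 = k * p + p"
    using pos_exponent[OF ob m, of x] x0 sx by (simp add: D2_def D3_def)
  let ?n = "inversions (whole W m) + ((\<Sum>(i, j)\<in>?P. interval_length m u (wcut m W) i * interval_length m u (wcut m W) j)
    + (\<Sum>i\<in>?I. wcut m W ! i))"
  let ?n' = "k * p + ((\<Sum>(i, j)\<in>?P. ?L i * ?L j) + (\<Sum>i\<in>?I. fcut m W ! i)) + inversions (tl (ones u W m))"
  have parity: "even a = even b" if "a + 2 * c = b + 2 * d + 2 * e" for a b c d e :: nat
    using that by presburger
  have "?n + 2 * (k * p) = ?n' + 2 * D1 + 2 * D3" using 1 2 3 4 by linarith
  then have "even ?n = even ?n'" by (rule parity)
  from minus_one_power_parity[OF this, where ?'k = 'k] show ?thesis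
    unfolding perm_sign_power pos_sign_power power_add[symmetric] .
qed

section \<open>Degenerate simplices\<close>

lemma mon_comp:
  assumes "\<alpha> \<in> mon m n" "\<beta> \<in> mon r m"
  shows "map (nth \<alpha>) \<beta> \<in> mon r n"
proof -
  have b: "b < length \<alpha>" if "b \<in> set \<beta>" for b using that assms by (auto simp: mon_def)
  have "sorted (map (nth \<alpha>) \<beta>)"
    using assms b unfolding mon_def
    by (auto simp: sorted_map intro!: sorted_wrt_mono_rel[of \<beta> "(\<le>)"] sorted_nth_mono)
  moreover have "\<alpha> ! i \<le> n" if "i \<in> set \<beta>" for i
    using nth_mem[OF b[OF that]] assms(1) by (auto simp: mon_def)
  ultimately show ?thesis using assms by (auto simp: mon_def)
qed

lemma sorted_not_distinct:
  fixes \<nu> :: "nat list"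
  assumes "sorted \<nu>" "\<not> distinct \<nu>"
  shows "\<exists>i. Suc i < length \<nu> \<and> \<nu> ! i = \<nu> ! Suc i"
proof (rule ccontr)
  assume *: "\<not> ?thesis"
  have "\<nu> ! i < \<nu> ! Suc i" if "Suc i < length \<nu>" for i
    using * that sorted_nth_mono[OF assms(1), of i "Suc i"] by fastforce
  then have "sorted_wrt (<) \<nu>" by (simp add: sorted_wrt_iff_nth_Suc_transp)
  then show False using assms(2) by (simp add: strict_sorted_iff)
qed

text \<open>The elementary degeneracy from \<open>[r]\<close> onto \<open>[r - 1]\<close> that takes
  the value \<open>i\<close> twice.\<close>

definition collapse :: "nat \<Rightarrow> nat \<Rightarrow> nat list" where
  "collapse r i = [0..<Suc i] @ [i..<r]"

lemma collapse_mon_surj: "i < r \<Longrightarrow> collapse r i \<in> mon_surj r (r - 1)"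
  by (auto simp: collapse_def mon_surj_def mon_def sorted_append simp del: upt_Suc)

lemma collapse_factor:
  assumes "\<nu> \<in> mon r n" "i < r" "\<nu> ! i = \<nu> ! Suc i"
  obtains \<delta> where "\<delta> \<in> mon (r - 1) n" "\<nu> = map (nth \<delta>) (collapse r i)"
proof -
  \<comment> \<open>One of the two equal neighbours is removed; \<open>collapse r i\<close> doubles
    the other one.\<close>
  let ?\<delta> = "take i \<nu> @ drop (Suc i) \<nu>"
  have len: "length \<nu> = Suc r" using assms by (simp add: mon_def)
  have "sorted ?\<delta>"
    using assms(1) len \<open>i < r\<close> unfolding mon_def
    by (auto simp: sorted_append sorted_wrt_take sorted_wrt_drop in_set_conv_nth less_diff_conv add.commute
        intro!: sorted_nth_mono)
  moreover have "set ?\<delta> \<subseteq> {0..n}"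
    using assms(1) set_take_subset[of i \<nu>] set_drop_subset[of "Suc i" \<nu>] by (auto simp: mon_def)
  ultimately have 1: "?\<delta> \<in> mon (r - 1) n" using len assms(2) by (simp add: mon_def)
  have "\<nu> = map (nth ?\<delta>) (collapse r i)"
  proof (rule nth_equalityI)
    show "length \<nu> = length (map (nth ?\<delta>) (collapse r i))"
      using len assms(2) by (simp add: collapse_def)
    fix t assume "t < length \<nu>"
    then consider "t < i" | "t = i" | "i < t" "t \<le> r" using len by linarith
    then show "\<nu> ! t = map (nth ?\<delta>) (collapse r i) ! t"
      using assms(2,3) len by cases (auto simp: collapse_def nth_append simp del: upt_Suc)
  qed
  with 1 that show ?thesis by blast
qed

text \<open>A monotone surjection onto a smaller ordinal takes the same value at two neighbours, by
  counting. This collapsed edge is what the vanishing arguments use.\<close>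

lemma degenerateE:
  assumes "degenerate X n x"
  obtains m \<sigma> y j where "y \<in> simplices X m" "\<sigma> \<in> mon n m" "j < n" "\<sigma> ! j = \<sigma> ! Suc j" "x = pull X m \<sigma> y"
proof -
  obtain m \<sigma> y where *: "m < n" "y \<in> simplices X m" "\<sigma> \<in> mon_surj n m" "x = pull X m \<sigma> y"
    using assms by (auto simp: degenerate_def)
  then have \<sigma>: "length \<sigma> = Suc n" "sorted \<sigma>" "set \<sigma> = {0..m}" by (auto simp: mon_surj_def mon_def)
  with \<open>m < n\<close> have "\<not> distinct \<sigma>" using distinct_card[of \<sigma>] by auto
  from sorted_not_distinct[OF \<sigma>(2) this] obtain j where "j < n" "\<sigma> ! j = \<sigma> ! Suc j" using \<sigma> by auto
  with * that show ?thesis by (auto simp: mon_surj_def)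
qed

text \<open>Both coordinates collapse the same edge, so they factor through the same elementary
  degeneracy.\<close>

lemma degenerate_sprod_pull:
  assumes "simplicial_set X" "simplicial_set Y" "x \<in> simplices X n" "y \<in> simplices Y m"
    "\<alpha> \<in> mon r n" "\<beta> \<in> mon r m" "i < r" "\<alpha> ! i = \<alpha> ! Suc i" "\<beta> ! i = \<beta> ! Suc i"
  shows "degenerate (X \<times>\<^sub>s Y) r (pull X n \<alpha> x, pull Y m \<beta> y)"
proof -
  obtain \<delta> where d: "\<delta> \<in> mon (r - 1) n" "\<alpha> = map (nth \<delta>) (collapse r i)"
    using collapse_factor assms by metis
  obtain \<epsilon> where e: "\<epsilon> \<in> mon (r - 1) m" "\<beta> = map (nth \<epsilon>) (collapse r i)"
    using collapse_factor assms by metis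
  have c: "collapse r i \<in> mon_surj r (r - 1)" by (rule collapse_mon_surj) fact
  then have c': "collapse r i \<in> mon r (r - 1)" by (simp add: mon_surj_def)
  have "(pull X n \<alpha> x, pull Y m \<beta> y) = pull (X \<times>\<^sub>s Y) (r - 1) (collapse r i) (pull X n \<delta> x, pull Y m \<epsilon> y)"
    using simplicial_set.pull_comp[OF assms(1,3) d(1) c'] simplicial_set.pull_comp[OF assms(2,4) e(1) c']
    by (simp add: sprod_def d e)
  moreover have "(pull X n \<delta> x, pull Y m \<epsilon> y) \<in> simplices (X \<times>\<^sub>s Y) (r - 1)"
    using simplicial_set.pull_closed[OF assms(1,3) d(1)] simplicial_set.pull_closed[OF assms(2,4) e(1)]
    by (simp add: sprod_def)
  moreover have "r - 1 < r" using assms by simp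
  ultimately show ?thesis using c unfolding degenerate_def by blast
qed

lemma degenerate_pull:
  assumes X: "simplicial_set X" and x: "x \<in> simplices X n" and \<nu>: "\<nu> \<in> mon r n" "\<not> distinct \<nu>"
  shows "degenerate X r (pull X n \<nu> x)"
proof -
  have len: "length \<nu> = Suc r" and "sorted \<nu>" using \<nu> by (auto simp: mon_def)
  from sorted_not_distinct[OF this(2) \<nu>(2)] len obtain i where i: "i < r" "\<nu> ! i = \<nu> ! Suc i" by auto
  obtain \<delta> where d: "\<delta> \<in> mon (r - 1) n" "\<nu> = map (nth \<delta>) (collapse r i)"
    using collapse_factor[OF \<nu>(1) i] by metis
  have c: "collapse r i \<in> mon_surj r (r - 1)" by (rule collapse_mon_surj) fact
  then have "collapse r i \<in> mon r (r - 1)" by (simp add: mon_surj_def)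
  then have "pull X n \<nu> x = pull X (r - 1) (collapse r i) (pull X n \<delta> x)"
    using simplicial_set.pull_comp[OF X x d(1)] d(2) by metis
  then show ?thesis
    using simplicial_set.pull_closed[OF X x d(1)] c i(1) unfolding degenerate_def
    by (intro exI[of _ "r - 1"]) auto
qed

lemma cls_degenerate: "degenerate X n x \<Longrightarrow> cls X (n, x) = 0"
  by (simp add: cls_def)

text \<open>Later intervals start no earlier than previous ones end, whence monotonicity. As the
  value \<open>s\<close> occurs, the list is non-empty and its length minus one is a genuine
  dimension.\<close>

lemma cut_vertices_mon:
  assumes p: "p \<in> cuts m n" and ex: "\<exists>i\<in>{1..m}. u i = s"
  shows "cut_vertices m u p s \<in> mon (length (cut_vertices m u p s) - 1) n"
    "length (cut_vertices m u p s) \<ge> 1"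
proof -
  let ?V = "joined (\<lambda>i. u i = s) (\<lambda>i. [p ! (i - 1)..<Suc (p ! i)])"
  have *: "sorted (?V j) \<and> set (?V j) \<subseteq> {0..p ! j}" if "j \<le> m" for j
    using that
  proof (induction j)
    case (Suc j)
    with cuts_mono[OF p, of j "Suc j"] show ?case by (force simp: sorted_append simp del: upt_Suc)
  qed simp
  obtain i where i: "i \<in> {1..m}" "u i = s" using ex by blast
  then have "[p ! (i - 1)..<Suc (p ! i)] \<noteq> []" using cuts_mono[OF p, of "i - 1" i] by simp
  with i have "?V m \<noteq> []" unfolding joined_empty_iff by blast
  moreover have "p ! m = n" using p by (simp add: cuts_def)
  ultimately show "cut_vertices m u p s \<in> mon (length (cut_vertices m u p s) - 1) n"
    "length (cut_vertices m u p s) \<ge> 1"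
    using *[of m] by (auto simp: mon_def cut_vertices_joined Suc_le_eq simp del: upt_Suc)
qed

lemma cuts_interval_ex:
  assumes p: "p \<in> cuts m n" and "j < n"
  shows "\<exists>i\<in>{1..m}. p ! (i - 1) \<le> j \<and> j < p ! i"
proof -
  \<comment> \<open>The first cut point beyond \<open>j\<close> ends an interval containing the edge
    from \<open>j\<close> to \<open>Suc j\<close>.\<close>
  define i where "i = (LEAST i. j < p ! i)"
  have pm: "j < p ! m" using assms by (simp add: cuts_def)
  then have "j < p ! i" unfolding i_def by (rule LeastI)
  moreover have "i \<le> m" unfolding i_def using pm by (rule Least_le)
  moreover have "i \<noteq> 0" using \<open>j < p ! i\<close> p unfolding cuts_def by (cases i) auto
  moreover have "\<not> j < p ! (i - 1)" using \<open>i \<noteq> 0\<close> not_less_Least[of "i - 1" "\<lambda>i. j < p ! i"] by (simp add: i_def)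
  ultimately show ?thesis by (intro bexI[of _ i]) auto
qed

section \<open>Linear maps\<close>

lemma linear_map_0: "linear_map f \<Longrightarrow> f 0 = 0"
  unfolding linear_map_def by (metis smul_simps(2))

lemma linear_map_smulD: "linear_map f \<Longrightarrow> f (smul r c) = smul r (f c)"
  by (simp add: linear_map_def)

lemma linear_map_eqI:
  assumes "linear_map f" "linear_map g" "\<And>b. b \<in> Poly_Mapping.keys c \<Longrightarrow> f (basis b) = g (basis b)"
  shows "f c = g c"
  unfolding linear_map_eq_lin[OF assms(1), of c] linear_map_eq_lin[OF assms(2), of c] lin_def
  using assms(3) by (intro sum.cong) auto

lemma linear_map_relabel: "linear_map (relabel h)"
  unfolding relabel_def by (rule linear_map_lin)

lemma relabel_basis: "relabel h (basis b) = basis (h b)"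
  by (simp add: relabel_def lin_basis)

lemma linear_map_tensor_map: "linear_map (tensor_map deg n f g)"
  unfolding tensor_map_def by (rule linear_map_lin)

lemma linear_map_tensor_power_map: "linear_map (tensor_power_map f)"
  unfolding tensor_power_map_def by (rule linear_map_lin)

lemma linear_map_id: "linear_map id"
  by (simp add: linear_map_def)

lemma linear_map_push: "linear_map (push Y h)"
  unfolding push_def by (rule linear_map_lin)

lemma linear_map_shuffle_map: "linear_map (shuffle_map X Y)"
  unfolding shuffle_map_def by (rule linear_map_lin)

lemma linear_map_AW: "linear_map (AW k l u X)"
  unfolding AW_def by (rule linear_map_lin)

lemma linear_map_AW_tilde: "linear_map (AW_tilde k l u X Y)"
  unfolding AW_tilde_def o_def
  by (rule linear_map_comp[OF linear_map_comp[OF linear_map_tensor_map linear_map_relabel] linear_map_AW])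

text \<open>For \<open>n = 0\<close> the Koszul sign is trivial, so the degree function can be
  replaced by a constant one, for which every chain is homogeneous.\<close>

lemma tensor_map_0_tens:
  assumes "linear_map f" "linear_map g"
  shows "tensor_map deg 0 f g (tens c d) = tens (f c) (g d)"
proof -
  have "tensor_map deg 0 f g = tensor_map (\<lambda>_. 0) 0 f g" by (simp add: tensor_map_def)
  then show ?thesis using tensor_map_koszul[OF assms, of c "\<lambda>_. 0" 0 0 d] by (simp add: smul_simps)
qed

lemma relabel_tens_list: "relabel (\<lambda>bs. (hd bs, tl bs)) (tens_list (c # cs)) = tens c (tens_list cs)"
proof -
  have "relabel (\<lambda>bs. (hd bs, tl bs)) (relabel (\<lambda>(b, bs). b # bs) t) = t" for t
    by (rule linear_map_eqI[of "\<lambda>t. relabel _ (relabel _ t)" id, unfolded id_apply])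
      (auto intro: linear_map_comp[OF linear_map_relabel linear_map_relabel] linear_map_id[unfolded id_def]
        simp: relabel_basis)
  then show ?thesis by simp
qed

lemma tensor_power_map_tens_list:
  fixes f :: "('b \<Rightarrow>\<^sub>0 'k) \<Rightarrow> 'd \<Rightarrow>\<^sub>0 'k::{comm_ring,comm_monoid_mult}"
  assumes f: "linear_map f"
  shows "tensor_power_map f (tens_list cs) = tens_list (map f cs)"
proof (induction cs)
  case Nil
  then show ?case by (simp add: tensor_power_map_def lin_basis)
next
  case (Cons c cs)
  let ?g = "tensor_power_map f"
  \<comment> \<open>On non-empty lists the tensor power is \<open>f \<otimes> ?g\<close>, up to the
    identification of pairs with lists.\<close>
  have "?g (relabel (\<lambda>(b, bs). b # bs) t)
      = relabel (\<lambda>(b, bs). b # bs) (tensor_map (\<lambda>_. 0) 0 f ?g t)" for t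
  proof (rule linear_map_eqI[of "\<lambda>t. ?g (relabel _ t)" "\<lambda>t. relabel _ (tensor_map _ _ _ _ t)"])
    fix z :: "'b \<times> 'b list"
    obtain b bs where z: "z = (b, bs)" by (cases z)
    have "?g (basis (b # bs)) = relabel (\<lambda>(b, bs). b # bs) (tens (f (basis b)) (?g (basis bs)))"
      by (simp add: tensor_power_map_def lin_basis)
    then show "?g (relabel (\<lambda>(b, bs). b # bs) (basis z))
        = relabel (\<lambda>(b, bs). b # bs) (tensor_map (\<lambda>_. 0) 0 f ?g (basis z))"
      by (simp add: z relabel_basis tensor_map_0_tens[OF f linear_map_tensor_power_map, where c = "basis b" and d = "basis bs", unfolded tens_basis])
  qed (rule linear_map_comp[OF linear_map_tensor_power_map linear_map_relabel]
      linear_map_comp[OF linear_map_relabel linear_map_tensor_map])+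
  then show ?case
    by (simp add: Cons tensor_map_0_tens[OF f linear_map_tensor_power_map])
qed

lemma tens_0: "tens 0 d = 0" "tens c 0 = 0"
  using linear_map_0[OF linear_map_tens_left] linear_map_0[OF linear_map_tens_right] by auto

lemma tens_list_0: "0 \<in> set cs \<Longrightarrow> tens_list cs = 0"
  by (induction cs) (auto simp: tens_0 linear_map_0[OF linear_map_relabel])

text \<open>Both sides are trilinear; agreement on basis elements is extended one argument at a
  time.\<close>

lemma tensor_assoc_tens:
  "tensor_assoc (tens a (tens b c)) = tens (tens a b) c"
proof -
  let ?l = "\<lambda>a b c. tensor_assoc (tens a (tens b c))" and ?r = "\<lambda>a b c. tens (tens a b) c"
  have l: "linear_map tensor_assoc" unfolding tensor_assoc_def by (rule linear_map_relabel)
  have l1: "linear_map (\<lambda>a. ?l a b c)" for b c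
    by (rule linear_map_comp[OF l linear_map_tens_left])
  have l2: "linear_map (\<lambda>b. ?l a b c)" for a c
    by (rule linear_map_comp[OF l linear_map_comp[OF linear_map_tens_right linear_map_tens_left]])
  have l3: "linear_map (?l a b)" for a b
    by (rule linear_map_comp[OF l linear_map_comp[OF linear_map_tens_right linear_map_tens_right]])
  have r1: "linear_map (\<lambda>a. ?r a b c)" for b c
    by (rule linear_map_comp[OF linear_map_tens_left linear_map_tens_left])
  have r2: "linear_map (\<lambda>b. ?r a b c)" for a c
    by (rule linear_map_comp[OF linear_map_tens_left linear_map_tens_right])
  have "?l (basis i) (basis j) (basis k) = ?r (basis i) (basis j) (basis k)" for i j k
    by (simp add: tens_basis tensor_assoc_def relabel_basis assoc_def)
  then have "?l (basis i) (basis j) c = ?r (basis i) (basis j) c" for i j c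
    by (rule linear_map_eqI[OF l3 linear_map_tens_right])
  then have "?l (basis i) b c = ?r (basis i) b c" for i b c
    by (rule linear_map_eqI[OF l2 r2])
  then show ?thesis
    by (rule linear_map_eqI[OF l1 r1])
qed

text \<open>The hypotheses say that \<open>h\<close> is simplicial. It therefore preserves
  degeneracy, and both sides vanish if \<open>x\<close> is degenerate.\<close>

lemma push_cls:
  assumes "simplicial_set X" "x \<in> simplices X n"
    and h: "\<And>m y. y \<in> simplices X m \<Longrightarrow> h y \<in> simplices Y m"
      "\<And>m r \<alpha> y. y \<in> simplices X m \<Longrightarrow> \<alpha> \<in> mon r m \<Longrightarrow> h (pull X m \<alpha> y) = pull Y m \<alpha> (h y)"
  shows "push Y h (cls X (n, x)) = cls Y (n, h x)"
proof (cases "degenerate X n x")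
  case True
  then obtain m \<sigma> y where *: "m < n" "y \<in> simplices X m" "\<sigma> \<in> mon_surj n m" "x = pull X m \<sigma> y"
    by (auto simp: degenerate_def)
  then have "h x = pull Y m \<sigma> (h y)" using h(2) by (auto simp: mon_surj_def)
  with * h(1) have "degenerate Y n (h x)" unfolding degenerate_def by blast
  then show ?thesis using True by (simp add: cls_def linear_map_0[OF linear_map_push])
next
  case False
  then show ?thesis by (simp add: cls_def[of X] push_def lin_basis)
qed

section \<open>The operations on possibly degenerate simplices\<close>

definition restrict_cls ::
    "'a sset \<Rightarrow> nat \<Rightarrow> 'a \<Rightarrow> nat list \<Rightarrow> 'a cell \<Rightarrow>\<^sub>0 'k::{comm_ring,comm_monoid_mult}" where
  "restrict_cls X n x \<nu> = cls X (length \<nu> - 1, pull X n \<nu> x)"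

lemma restrict_cls_not_distinct:
  assumes "simplicial_set X" "x \<in> simplices X n" "\<nu> \<in> mon (length \<nu> - 1) n" "\<not> distinct \<nu>"
  shows "restrict_cls X n x \<nu> = 0"
  unfolding restrict_cls_def by (rule cls_degenerate, rule degenerate_pull) (rule assms)+

text \<open>
  For degenerate simplices this is a statement of its own: the sum vanishes term by
  term, because a collapsed edge lies in some interval of every cut.
\<close>

lemma AW_cls:
  assumes X: "simplicial_set X" and x: "x \<in> simplices X n" and u: "u ` {1..k + l} = {1..l}"
  shows "AW k l u X (cls X (n, x) :: 'a cell \<Rightarrow>\<^sub>0 'k::{comm_ring,comm_monoid_mult}) = (\<Sum>p\<in>cuts (k + l) n.
    smul (perm_sign (k + l) u p * pos_sign (k + l) u p)
      (tens_list (map (\<lambda>s. restrict_cls X n x (cut_vertices (k + l) u p s)) [1..<Suc l])))"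
proof (cases "degenerate X n x")
  case False
  then show ?thesis by (simp add: cls_def[of X] AW_def lin_basis restrict_cls_def o_def del: upt_Suc)
next
  case True
  then obtain m \<sigma> y j where y: "y \<in> simplices X m" "\<sigma> \<in> mon n m" "x = pull X m \<sigma> y"
    and j: "j < n" "\<sigma> ! j = \<sigma> ! Suc j" by (rule degenerateE)
  let ?r = "restrict_cls X n x :: _ \<Rightarrow> _ \<Rightarrow>\<^sub>0 'k"
  have "tens_list (map (\<lambda>s. ?r (cut_vertices (k + l) u p s)) [1..<Suc l]) = 0"
    if p: "p \<in> cuts (k + l) n" for p
  proof (rule tens_list_0)
    obtain i where i: "i \<in> {1..k + l}" "p ! (i - 1) \<le> j" "j < p ! i"
      using cuts_interval_ex[OF p j(1)] by blast
    let ?V = "cut_vertices (k + l) u p (u i)"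
    have V: "?V \<in> mon (length ?V - 1) n" by (rule cut_vertices_mon[OF p]) (use i in auto)
    have mem: "j \<in> set [p ! (i - 1)..<Suc (p ! i)]" "Suc j \<in> set [p ! (i - 1)..<Suc (p ! i)]"
      using i by auto
    have "\<not> inj_on (nth \<sigma>) (set [p ! (i - 1)..<Suc (p ! i)])"
    proof
      assume "inj_on (nth \<sigma>) (set [p ! (i - 1)..<Suc (p ! i)])"
      from inj_onD[OF this j(2) mem] show False by simp
    qed
    then have "\<not> distinct (map (nth \<sigma>) [p ! (i - 1)..<Suc (p ! i)])" by (simp add: distinct_map del: upt_Suc)
    then have "\<not> distinct (map (nth \<sigma>) ?V)"
      unfolding cut_vertices_joined map_joined
      by (rule contrapos_nn) (erule distinct_joined[where i = i], use i(1) in auto)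
    then have "degenerate X (length ?V - 1) (pull X m (map (nth \<sigma>) ?V) y)"
      by (intro degenerate_pull[OF X y(1)] mon_comp[OF y(2) V])
    then have "?r ?V = 0"
      using simplicial_set.pull_comp[OF X y(1,2) V] y(3) by (simp add: restrict_cls_def cls_degenerate)
    moreover have "u i \<in> set [1..<Suc l]"
    proof -
      have "u i \<in> u ` {1..k + l}" using i(1) by simp
      then show ?thesis unfolding u by auto
    qed
    ultimately show "0 \<in> set (map (\<lambda>s. ?r (cut_vertices (k + l) u p s)) [1..<Suc l])"
      unfolding set_map by (intro image_eqI[where x = "u i"]) auto
  qed
  then show ?thesis
    using True by (simp add: cls_degenerate linear_map_0[OF linear_map_AW] smul_simps del: upt_Suc)
qed

text \<open>The projections are simplicial, so \<open>push_cls\<close> evaluates them on every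
  tensor factor, degenerate or not.\<close>

lemma AW_tilde_cls:
  assumes X: "simplicial_set X" and Y: "simplicial_set Y"
    and x: "x \<in> simplices X n" and y: "y \<in> simplices Y n"
    and u: "one_biased k (l + 1) u" and m: "m = k + (l + 1)"
  shows "AW_tilde k l u X Y (cls (X \<times>\<^sub>s Y) (n, (x, y)) :: _ \<Rightarrow>\<^sub>0 'k::{comm_ring,comm_monoid_mult}) = (\<Sum>p\<in>cuts m n.
    smul (perm_sign m u p * pos_sign m u p)
      (tens (restrict_cls X n x (cut_vertices m u p 1))
        (tens_list (map (\<lambda>s. restrict_cls Y n y (cut_vertices m u p s)) [2..<l + 2]))))"
proof -
  let ?XY = "X \<times>\<^sub>s Y" and ?V = "cut_vertices m u"
  let ?rX = "restrict_cls X n x :: _ \<Rightarrow> _ \<Rightarrow>\<^sub>0 'k" and ?rY = "restrict_cls Y n y :: _ \<Rightarrow> _ \<Rightarrow>\<^sub>0 'k"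
    and ?r = "restrict_cls ?XY n (x, y) :: _ \<Rightarrow> _ \<Rightarrow>\<^sub>0 'k"
  let ?F = "tensor_map fst 0 (push X fst) (tensor_power_map (push Y snd)) \<circ> relabel (\<lambda>bs. (hd bs, tl bs))"
  have F: "linear_map ?F" unfolding o_def
    by (rule linear_map_comp[OF linear_map_tensor_map linear_map_relabel])
  have XY: "simplicial_set ?XY" by (rule simplicial_set_sprod[OF X Y])
  have xy: "(x, y) \<in> simplices ?XY n" using x y by (simp add: sprod_def)
  have img: "u ` {1..k + (l + 1)} = {1..l + 1}" using u by (simp add: one_biased_def nondeg_surj_def)
  have upt: "[1..<Suc (l + 1)] = 1 # [2..<l + 2]" by (simp add: upt_conv_Cons numeral_2_eq_2 del: upt_Suc)
  have "?F (tens_list (map (\<lambda>s. ?r (?V p s)) [1..<Suc (l + 1)]))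
      = tens (?rX (?V p 1)) (tens_list (map (\<lambda>s. ?rY (?V p s)) [2..<l + 2]))"
    if p: "p \<in> cuts m n" for p
  proof -
    have V: "pull ?XY n (?V p s) (x, y) \<in> simplices ?XY (length (?V p s) - 1)" if "1 \<le> s" "s \<le> l + 1" for s
      by (rule simplicial_set.pull_closed[OF XY xy cut_vertices_mon(1)[OF p]])
        (use one_biased_ex[OF u that] m in simp)
    have fst: "push X fst (?r (?V p s)) = ?rX (?V p s)"
      if "1 \<le> s" "s \<le> l + 1" for s
      unfolding restrict_cls_def by (subst push_cls[OF XY V[OF that]]) (auto simp: sprod_def)
    have snd: "push Y snd (?r (?V p s)) = ?rY (?V p s)"
      if "1 \<le> s" "s \<le> l + 1" for s
      unfolding restrict_cls_def by (subst push_cls[OF XY V[OF that]]) (auto simp: sprod_def)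
    have snds: "map (\<lambda>s. push Y snd (?r (?V p s))) [2..<l + 2]
        = map (\<lambda>s. ?rY (?V p s)) [2..<l + 2]"
      by (rule map_cong) (auto intro!: snd)
    have fst1: "push X fst (?r (?V p 1)) = ?rX (?V p 1)" by (rule fst) auto
    show ?thesis
      unfolding upt list.map o_def relabel_tens_list
        tensor_map_0_tens[OF linear_map_push linear_map_tensor_power_map]
        tensor_power_map_tens_list[OF linear_map_push] map_map
      unfolding o_def snds fst1 ..
  qed
  then show ?thesis
    unfolding AW_tilde_def comp_apply[of ?F] AW_cls[OF XY xy img] linear_map_sum[OF F] m
    by (intro sum.cong) auto
qed

lemma shuffle_map_basis:
  "shuffle_map X Y (basis ((p, x), (q, y))) = (\<Sum>w\<in>words p q. smul ((- 1) ^ inversions w)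
    (cls (X \<times>\<^sub>s Y) (p + q, (pull X p (walk True 0 w) x, pull Y q (walk False 0 w) y))))"
proof -
  have "shuffle_map X Y (basis ((p, x), (q, y))) = (\<Sum>z\<in>shuffle_pairs p q.
      smul (shuffle_sign p q (fst z) (snd z)) (cls (X \<times>\<^sub>s Y) (p + q, (pull X p (fst z) x, pull Y q (snd z) y))))"
    by (simp add: shuffle_map_def lin_basis case_prod_unfold)
  also have "\<dots> = (\<Sum>w\<in>words p q. smul ((- 1) ^ inversions w)
      (cls (X \<times>\<^sub>s Y) (p + q, (pull X p (walk True 0 w) x, pull Y q (walk False 0 w) y))))"
    unfolding sum.reindex_bij_betw[OF bij_walk, symmetric] by (simp add: shuffle_sign_walk)
  finally show ?thesis .
qed

text \<open>The step is the letter \<open>False\<close> with exactly \<open>j\<close> letters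
  \<open>False\<close> before it.\<close>

lemma walk_passes:
  assumes "j < count_list w False"
  shows "\<exists>i<length w. \<not> w ! i \<and> walk False 0 w ! i = j"
proof -
  obtain v t where w: "w = v @ False # t" and v: "count_list v False = j"
    using split_at_False[of w j "count_list w False - Suc j"] assms by auto
  then show ?thesis by (intro exI[of _ "length v"]) (simp add: walk_nth)
qed

text \<open>In the second composite the value \<open>1\<close> part of \<open>y\<close> may be
  degenerate. In every shuffle \<mu> crosses the collapsed edge at a step where \<lambda> stands
  still, so each term is degenerate.\<close>

lemma shuffle_map_cls:
  assumes X: "simplicial_set X" and Y: "simplicial_set Y"
    and x: "x \<in> simplices X p" and y: "y \<in> simplices Y q"
  shows "shuffle_map X Y (tens (basis (p, x)) (cls Y (q, y) :: _ \<Rightarrow>\<^sub>0 'k::{comm_ring,comm_monoid_mult})) = (\<Sum>w\<in>words p q. smul ((- 1) ^ inversions w)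
    (cls (X \<times>\<^sub>s Y) (p + q, (pull X p (walk True 0 w) x, pull Y q (walk False 0 w) y))))"
proof (cases "degenerate Y q y")
  case False
  then have "cls Y (q, y) = (basis (q, y) :: _ \<Rightarrow>\<^sub>0 'k)" by (simp add: cls_def)
  then show ?thesis by (simp only: tens_basis shuffle_map_basis)
next
  case True
  then obtain m \<sigma> y' j where y': "y' \<in> simplices Y m" "\<sigma> \<in> mon q m" "y = pull Y m \<sigma> y'"
    and j: "j < q" "\<sigma> ! j = \<sigma> ! Suc j" by (rule degenerateE)
  have "cls (X \<times>\<^sub>s Y) (p + q, (pull X p (walk True 0 w) x, pull Y q (walk False 0 w) y)) = (0 :: _ \<Rightarrow>\<^sub>0 'k)"
    if w: "w \<in> words p q" for w
  proof -
    have \<beta>: "walk False 0 w \<in> mon (p + q) q" and \<alpha>: "walk True 0 w \<in> mon (p + q) p"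
      using walk_mon_surj[OF w] by (auto simp: mon_surj_def)
    have "j < count_list w False" using w j(1) by (simp add: words_def)
    then obtain i where i: "i < length w" "\<not> w ! i" "walk False 0 w ! i = j" using walk_passes by blast
    have len: "length w = p + q" using w count_list_length[of w] by (simp add: words_def)
    have "degenerate (X \<times>\<^sub>s Y) (p + q) (pull X p (walk True 0 w) x, pull Y m (map (nth \<sigma>) (walk False 0 w)) y')"
      by (rule degenerate_sprod_pull[OF X Y x y'(1) \<alpha> mon_comp[OF y'(2) \<beta>], of i])
        (use i len j(2) in \<open>auto simp: walk_nth_Suc\<close>)
    then show ?thesis
      using simplicial_set.pull_comp[OF Y y'(1,2) \<beta>] y'(3) by (simp add: cls_degenerate)
  qed
  then show ?thesis
    using True by (simp add: cls_degenerate tens_0 linear_map_0[OF linear_map_shuffle_map] smul_simps)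
qed

section \<open>Comparison of the two composites\<close>

lemma vertices_one:
  assumes W: "W \<in> good_families m u p q" and ex: "\<exists>i\<in>{1..m}. u i = 1"
  defines "w \<equiv> tl (ones u W m)"
  shows "map (nth (walk True 0 (whole W m))) (cut_vertices m u (wcut m W) 1) = walk True 0 w"
    "map (nth (walk False 0 (whole W m))) (cut_vertices m u (wcut m W) 1)
      = map (nth (cut_vertices m u (fcut m W) 1)) (walk False 0 w)"
proof -
  have w: "ones u W m = False # w" unfolding w_def by (rule ones_Cons[OF ex])
  show "map (nth (walk True 0 (whole W m))) (cut_vertices m u (wcut m W) 1) = walk True 0 w"
    using vertices_one_True[of m u W] W unfolding w by (simp add: good_families_def)
  show "map (nth (walk False 0 (whole W m))) (cut_vertices m u (wcut m W) 1)
      = map (nth (cut_vertices m u (fcut m W) 1)) (walk False 0 w)"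
    \<comment> \<open>After the first letter the walk starts at \<open>1\<close>, so removing the
      dummy vertex lowers all indices by one.\<close>
    using vertices_one_False[of 0 W m u] walk_shift[of False 1 0 w] unfolding w by simp
qed

text \<open>\<mu> stands still at a step of \<lambda> and thus repeats a vertex in this interval.
  For \<open>u i \<noteq> 1\<close> this makes a factor from \<open>Z\<close> vanish.\<close>

lemma vertices_bad:
  assumes W: "i \<in> {1..m}" "True \<in> set (W i)"
  shows "\<not> distinct (map (nth (walk False 0 (whole W m))) (cut_vertices m u (wcut m W) (u i)))"
proof
  assume "distinct (map (nth (walk False 0 (whole W m))) (cut_vertices m u (wcut m W) (u i)))"
  then have "distinct (map (nth (walk False 0 (whole W m))) [wcut m W ! (i - 1)..<Suc (wcut m W ! i)])"
    unfolding cut_vertices_joined map_joined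
    by (rule distinct_joined[where i = i]) (use W in auto)
  then show False
    using walk_interval[of i m False W] walk_not_distinct[of False "W i"] W by simp
qed

text \<open>The left sum is reindexed by \<open>bij_families\<close>; the terms outside
  \<open>good_families\<close> vanish, and the others are matched with the right sum by
  \<open>bij_good_families\<close>.\<close>

lemma shuffle_cut_exchange:
  fixes X :: "'a sset" and Y :: "'b sset" and Z :: "'c sset"
  assumes X: "simplicial_set X" and Y: "simplicial_set Y" and Z: "simplicial_set Z"
    and ob: "one_biased k (l + 1) u" and m: "m = k + (l + 1)"
    and x: "x \<in> simplices X p" and y: "y \<in> simplices Y q" and z: "z \<in> simplices Z q"
  defines "V \<equiv> cut_vertices m u"
  shows "(\<Sum>w\<in>words p q. \<Sum>P\<in>cuts m (p + q).
      smul ((- 1) ^ inversions w * (perm_sign m u P * pos_sign m u P))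
        (tens (restrict_cls (X \<times>\<^sub>s Y) (p + q) (pull X p (walk True 0 w) x, pull Y q (walk False 0 w) y) (V P 1))
          (tens_list (map (\<lambda>s. restrict_cls Z (p + q) (pull Z q (walk False 0 w) z) (V P s)) [2..<l + 2]))))
    = (\<Sum>Q\<in>cuts m q. \<Sum>w\<in>words p (length (V Q 1) - 1).
      smul ((- 1) ^ (k * p) * (perm_sign m u Q * pos_sign m u Q) * (- 1) ^ inversions w)
        (tens (cls (X \<times>\<^sub>s Y) (p + (length (V Q 1) - 1),
              (pull X p (walk True 0 w) x, pull Y (length (V Q 1) - 1) (walk False 0 w) (pull Y q (V Q 1) y))))
          (tens_list (map (\<lambda>s. restrict_cls Z q z (V Q s)) [2..<l + 2]))
        :: _ \<Rightarrow>\<^sub>0 'k::{comm_ring,comm_monoid_mult}))"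
    (is "(\<Sum>w\<in>_. \<Sum>P\<in>_. ?f w P) = (\<Sum>Q\<in>_. \<Sum>w\<in>_. ?g Q w)")
proof -
  have ex: "\<exists>i\<in>{1..m}. u i = s" if "1 \<le> s" "s \<le> l + 1" for s
    using one_biased_ex[OF ob that] by (simp add: m)
  have ex1: "\<exists>i\<in>{1..m}. u i = 1" by (rule ex) auto
  \<comment> \<open>Both walks are treated at once: \<open>b\<close> selects \<lambda> with target
    \<open>[p]\<close> or \<mu> with target \<open>[q]\<close>.\<close>
  have comp_mon: "map (nth (walk b 0 w)) (V P s) \<in> mon (length (V P s) - 1) (if b then p else q)"
    and pull_walk: "pull S (p + q) (V P s) (pull S (if b then p else q) (walk b 0 w) a)
      = pull S (if b then p else q) (map (nth (walk b 0 w)) (V P s)) a"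
    if "w \<in> words p q" "P \<in> cuts m (p + q)" "1 \<le> s" "s \<le> l + 1" "simplicial_set S"
      "a \<in> simplices S (if b then p else q)" for b w P s a and S :: "'s sset"
  proof -
    have w: "walk b 0 w \<in> mon (p + q) (if b then p else q)"
      using walk_mon_surj[OF that(1)] by (cases b) (auto simp: mon_surj_def)
    have V: "V P s \<in> mon (length (V P s) - 1) (p + q)"
      unfolding V_def by (rule cut_vertices_mon(1)[OF that(2) ex[OF that(3,4)]])
    show "map (nth (walk b 0 w)) (V P s) \<in> mon (length (V P s) - 1) (if b then p else q)"
      by (rule mon_comp[OF w V])
    show "pull S (p + q) (V P s) (pull S (if b then p else q) (walk b 0 w) a)
        = pull S (if b then p else q) (map (nth (walk b 0 w)) (V P s)) a"
      by (rule simplicial_set.pull_comp[OF that(5,6) w V])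
  qed
  have restrict_Z: "restrict_cls Z (p + q) (pull Z q (walk False 0 w) z) (V P s)
      = (restrict_cls Z q z (map (nth (walk False 0 w)) (V P s)) :: _ \<Rightarrow>\<^sub>0 'k)"
    if "w \<in> words p q" "P \<in> cuts m (p + q)" "1 \<le> s" "s \<le> l + 1" for w P s
    using pull_walk[OF that Z, of z False] z by (simp add: restrict_cls_def)
  have WP: "whole W m \<in> words p q" "wcut m W \<in> cuts m (p + q)" if "W \<in> families m p q" for W
    using bij_betwE[OF bij_families, rule_format, OF that] by auto
  have bad: "?f (whole W m) (wcut m W) = 0" if W: "W \<in> families m p q - good_families m u p q" for W
  proof -
    obtain i where i: "i \<in> {1..m}" "u i \<noteq> 1" "True \<in> set (W i)"
      using W by (auto simp: good_families_def)
    have s: "1 \<le> u i" "u i \<le> l + 1" using one_biased_range[OF ob, of i] i by (auto simp: m)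
    have wp: "whole W m \<in> words p q" "wcut m W \<in> cuts m (p + q)" using WP W by auto
    let ?\<nu> = "map (nth (walk False 0 (whole W m))) (V (wcut m W) (u i))"
    have "?\<nu> \<in> mon (length ?\<nu> - 1) q"
      using comp_mon[OF wp s Z, of z False] z by simp
    then have "restrict_cls Z q z ?\<nu> = (0 :: _ \<Rightarrow>\<^sub>0 'k)"
      by (rule restrict_cls_not_distinct[OF Z z]) (unfold V_def, rule vertices_bad[where i = i and W = W, OF i(1) i(3)])
    then have "restrict_cls Z (p + q) (pull Z q (walk False 0 (whole W m)) z) (V (wcut m W) (u i)) = (0 :: _ \<Rightarrow>\<^sub>0 'k)"
      using restrict_Z[OF wp s] by simp
    moreover have "u i \<in> set [2..<l + 2]" using s i(2) by auto
    ultimately show ?thesis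
      by (subst tens_list_0) (auto simp: image_iff tens_0 smul_simps intro!: bexI[of _ "u i"])
  qed
  have good: "?f (whole W m) (wcut m W) = ?g (fcut m W) (tl (ones u W m))"
    if W: "W \<in> good_families m u p q" for W
  proof -
    have fam: "W \<in> families m p q" using W by (simp add: good_families_def)
    let ?w = "whole W m" and ?P = "wcut m W" and ?Q = "fcut m W" and ?w' = "tl (ones u W m)"
    note wp = WP[OF fam]
    have Qw: "?Q \<in> cuts m q" "?w' \<in> words p (length (V ?Q 1) - 1)"
      using bij_betwE[OF bij_good_families[OF ex1], rule_format, OF W] by (auto simp: V_def)
    note v = vertices_one[OF W ex1, folded V_def]
    \<comment> \<open>The dimension of the first factor is the length of the restricted word, that
      is, \<open>p\<close> steps of \<lambda> and one of \<mu> for each step of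
      \<open>V ?Q 1\<close>.\<close>
    have "length (V ?P 1) = length (walk True 0 ?w')" using arg_cong[OF v(1), of length] by simp
    then have len: "length (V ?P 1) - 1 = p + (length (V ?Q 1) - 1)"
      using Qw(2) count_list_length[of ?w'] by (simp add: words_def)
    have VQ: "V ?Q 1 \<in> mon (length (V ?Q 1) - 1) q"
      unfolding V_def by (rule cut_vertices_mon(1)[OF Qw(1) ex1])
    have "walk False 0 ?w' \<in> mon (p + (length (V ?Q 1) - 1)) (length (V ?Q 1) - 1)"
      using walk_mon_surj(2)[OF Qw(2)] by (simp add: mon_surj_def)
    from simplicial_set.pull_comp[OF Y y VQ this]
    have "restrict_cls (X \<times>\<^sub>s Y) (p + q) (pull X p (walk True 0 ?w) x, pull Y q (walk False 0 ?w) y) (V ?P 1)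
        = (cls (X \<times>\<^sub>s Y) (p + (length (V ?Q 1) - 1), (pull X p (walk True 0 ?w') x,
            pull Y (length (V ?Q 1) - 1) (walk False 0 ?w') (pull Y q (V ?Q 1) y))) :: _ \<Rightarrow>\<^sub>0 'k)"
      using pull_walk[OF wp _ _ X, of 1 x True] pull_walk[OF wp _ _ Y, of 1 y False] x y
      by (simp add: restrict_cls_def sprod_def len[simplified] v[simplified])
    moreover have "map (\<lambda>s. restrict_cls Z (p + q) (pull Z q (walk False 0 ?w) z) (V ?P s)) [2..<l + 2]
        = map (\<lambda>s. restrict_cls Z q z (V ?Q s) :: _ \<Rightarrow>\<^sub>0 'k) [2..<l + 2]"
    proof (rule map_cong)
      fix s assume s: "s \<in> set [2..<l + 2]"
      then have "map (nth (walk False 0 ?w)) (V ?P s) = V ?Q s"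
        unfolding V_def by (intro vertices_other) (use W in \<open>auto simp: good_families_def\<close>)
      then show "restrict_cls Z (p + q) (pull Z q (walk False 0 ?w) z) (V ?P s) = (restrict_cls Z q z (V ?Q s) :: _ \<Rightarrow>\<^sub>0 'k)"
        using restrict_Z[OF wp, of s] s by auto
    qed simp
    ultimately show ?thesis unfolding good_family_signs[OF ob m W] by (simp only:)
  qed
  have "(\<Sum>w\<in>words p q. \<Sum>P\<in>cuts m (p + q). ?f w P) = (\<Sum>(w, P)\<in>words p q \<times> cuts m (p + q). ?f w P)"
    by (rule sum.cartesian_product)
  also have "\<dots> = (\<Sum>W\<in>families m p q. ?f (whole W m) (wcut m W))"
    using sum.reindex_bij_betw[OF bij_families, of "\<lambda>(w, P). ?f w P" m p q] by simp
  also have "\<dots> = (\<Sum>W\<in>good_families m u p q. ?f (whole W m) (wcut m W))"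
    by (rule sum.mono_neutral_right[OF finite_families]) (use bad in \<open>auto simp: good_families_def\<close>)
  also have "\<dots> = (\<Sum>W\<in>good_families m u p q. ?g (fcut m W) (tl (ones u W m)))"
    by (rule sum.cong[OF refl good])
  also have "\<dots> = (\<Sum>(Q, w)\<in>(SIGMA Q:cuts m q. words p (length (V Q 1) - 1)). ?g Q w)"
    using sum.reindex_bij_betw[OF bij_good_families[OF ex1], of "\<lambda>(Q, w). ?g Q w" p q] by (simp add: V_def)
  also have "\<dots> = (\<Sum>Q\<in>cuts m q. \<Sum>w\<in>words p (length (V Q 1) - 1). ?g Q w)"
    by (rule sum.Sigma[symmetric]) (auto simp: finite_cuts finite_words)
  finally show ?thesis .
qed

section \<open>Evaluation of both composites on basis elements\<close>

theorem theorem3p3: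
  fixes X :: "'a sset" and Y :: "'b sset" and Z :: "'c sset"
    and k l :: nat and u :: "nat \<Rightarrow> nat"
  assumes "simplicial_set X" and "simplicial_set Y" and "simplicial_set Z"
    and "one_biased k (l + 1) u"
  shows "\<forall>c \<in> (free_on (nondeg X \<times> nondeg (Y \<times>\<^sub>s Z)) ::
            ('a cell \<times> ('b \<times> 'c) cell \<Rightarrow>\<^sub>0 'k::{comm_ring,comm_monoid_mult}) set).
          (AW_tilde k l u (X \<times>\<^sub>s Y) Z \<circ> chains_assoc X Y Z \<circ> shuffle_map X (Y \<times>\<^sub>s Z)) c
        = (tensor_map (\<lambda>(a, b). fst a + fst b) 0 (shuffle_map X Y) id
            \<circ> tensor_assoc \<circ> tensor_map fst k id (AW_tilde k l u Y Z)) c"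
proof
  fix c :: "'a cell \<times> ('b \<times> 'c) cell \<Rightarrow>\<^sub>0 'k"
  assume c: "c \<in> free_on (nondeg X \<times> nondeg (Y \<times>\<^sub>s Z))"
  note XYZ = assms(1-3) and ob = assms(4)
  define m where "m = k + (l + 1)"
  let ?V = "cut_vertices m u"
  let ?A = "AW_tilde k l u (X \<times>\<^sub>s Y) Z :: _ \<Rightarrow> _ \<Rightarrow>\<^sub>0 'k" and ?A' = "AW_tilde k l u Y Z :: _ \<Rightarrow> _ \<Rightarrow>\<^sub>0 'k"
  let ?T = "tensor_map (\<lambda>(a, b). fst a + fst b) 0 (shuffle_map X Y) id :: _ \<Rightarrow> _ \<Rightarrow>\<^sub>0 'k"
  let ?L = "\<lambda>c. ?A (chains_assoc X Y Z (shuffle_map X (Y \<times>\<^sub>s Z) c))"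
  let ?R = "\<lambda>c. ?T (tensor_assoc (tensor_map fst k id ?A' c))"
  have ca: "linear_map (chains_assoc X Y Z)" unfolding chains_assoc_def by (rule linear_map_push)
  have ta: "linear_map tensor_assoc" unfolding tensor_assoc_def by (rule linear_map_relabel)
  have "?L c = ?R c"
  proof (rule linear_map_eqI[of ?L ?R])
    show "linear_map ?L"
      by (rule linear_map_comp[OF linear_map_AW_tilde linear_map_comp[OF ca linear_map_shuffle_map]])
    show "linear_map ?R"
      by (rule linear_map_comp[OF linear_map_tensor_map linear_map_comp[OF ta linear_map_tensor_map]])
    fix b assume "b \<in> Poly_Mapping.keys c"
    with c have b: "b \<in> nondeg X \<times> nondeg (Y \<times>\<^sub>s Z)" by (auto simp: free_on_def)
    obtain p x q y z where bs: "b = ((p, x), (q, (y, z)))" by (metis prod.collapse)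
    have x: "x \<in> simplices X p" and y: "y \<in> simplices Y q" and z: "z \<in> simplices Z q"
      and nd: "\<not> degenerate (Y \<times>\<^sub>s Z) q (y, z)"
      using b by (auto simp: bs nondeg_def sprod_def)
    note XY = simplicial_set_sprod[OF XYZ(1,2)] and YZ = simplicial_set_sprod[OF XYZ(2,3)]
    have "?L (basis b) = (\<Sum>w\<in>words p q. \<Sum>P\<in>cuts m (p + q).
      smul ((- 1) ^ inversions w * (perm_sign m u P * pos_sign m u P))
        (tens (restrict_cls (X \<times>\<^sub>s Y) (p + q) (pull X p (walk True 0 w) x, pull Y q (walk False 0 w) y) (?V P 1))
          (tens_list (map (\<lambda>s. restrict_cls Z (p + q) (pull Z q (walk False 0 w) z) (?V P s)) [2..<l + 2]))))"
      unfolding bs shuffle_map_basis linear_map_sum[OF ca] linear_map_sum[OF linear_map_AW_tilde]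
    proof (rule sum.cong[OF refl])
      fix w assume w: "w \<in> words p q"
      have mon: "walk True 0 w \<in> mon (p + q) p" "walk False 0 w \<in> mon (p + q) q"
        using walk_mon_surj[OF w] by (auto simp: mon_surj_def)
      let ?x = "pull X p (walk True 0 w) x" and ?y = "pull Y q (walk False 0 w) y"
        and ?z = "pull Z q (walk False 0 w) z"
      have s: "?x \<in> simplices X (p + q)" "?y \<in> simplices Y (p + q)" "?z \<in> simplices Z (p + q)"
        using simplicial_set.pull_closed[OF XYZ(1) x mon(1)] simplicial_set.pull_closed[OF XYZ(2) y mon(2)]
          simplicial_set.pull_closed[OF XYZ(3) z mon(2)] by auto
      have "chains_assoc X Y Z (cls (X \<times>\<^sub>s Y \<times>\<^sub>s Z) (p + q, (?x, (?y, ?z))))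
          = (cls ((X \<times>\<^sub>s Y) \<times>\<^sub>s Z) (p + q, ((?x, ?y), ?z)) :: _ \<Rightarrow>\<^sub>0 'k)"
        unfolding chains_assoc_def
        by (subst push_cls[OF simplicial_set_sprod[OF XYZ(1) YZ]]) (use s in \<open>auto simp: sprod_def assoc_def\<close>)
      then have "?A (chains_assoc X Y Z (cls (X \<times>\<^sub>s Y \<times>\<^sub>s Z) (p + q, (?x, pull (Y \<times>\<^sub>s Z) q (walk False 0 w) (y, z)))))
        = ?A (cls ((X \<times>\<^sub>s Y) \<times>\<^sub>s Z) (p + q, ((?x, ?y), ?z)) :: _ \<Rightarrow>\<^sub>0 'k)"
        by (simp add: sprod_def)
      also have "\<dots> = (\<Sum>P\<in>cuts m (p + q). smul (perm_sign m u P * pos_sign m u P)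
        (tens (restrict_cls (X \<times>\<^sub>s Y) (p + q) (?x, ?y) (?V P 1))
          (tens_list (map (\<lambda>s. restrict_cls Z (p + q) ?z (?V P s)) [2..<l + 2]))))"
        by (rule AW_tilde_cls[OF XY XYZ(3) _ s(3) ob m_def]) (use s in \<open>simp add: sprod_def\<close>)
      finally show "smul ((- 1) ^ inversions w) (?A (chains_assoc X Y Z
            (cls (X \<times>\<^sub>s Y \<times>\<^sub>s Z) (p + q, (?x, pull (Y \<times>\<^sub>s Z) q (walk False 0 w) (y, z))))))
          = (\<Sum>P\<in>cuts m (p + q). smul ((- 1) ^ inversions w * (perm_sign m u P * pos_sign m u P))
            (tens (restrict_cls (X \<times>\<^sub>s Y) (p + q) (?x, ?y) (?V P 1))
              (tens_list (map (\<lambda>s. restrict_cls Z (p + q) ?z (?V P s)) [2..<l + 2]))))"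
        by (simp only: smul_sum smul_simps(4))
    qed
    also have "\<dots> = (\<Sum>Q\<in>cuts m q. \<Sum>w\<in>words p (length (?V Q 1) - 1).
      smul ((- 1) ^ (k * p) * (perm_sign m u Q * pos_sign m u Q) * (- 1) ^ inversions w)
        (tens (cls (X \<times>\<^sub>s Y) (p + (length (?V Q 1) - 1),
              (pull X p (walk True 0 w) x, pull Y (length (?V Q 1) - 1) (walk False 0 w) (pull Y q (?V Q 1) y))))
          (tens_list (map (\<lambda>s. restrict_cls Z q z (?V Q s)) [2..<l + 2]))))"
      by (rule shuffle_cut_exchange[OF XYZ ob m_def x y z])
    also have "\<dots> = ?R (basis b)"
    proof -
      let ?D = "\<lambda>Q. tens_list (map (\<lambda>s. restrict_cls Z q z (?V Q s)) [2..<l + 2]) :: _ \<Rightarrow>\<^sub>0 'k"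
      \<comment> \<open>As \<open>(y, z)\<close> is nondegenerate, the basis element is its class
        and the formula for classes applies.\<close>
      have "?A' (basis (q, (y, z))) = ?A' (cls (Y \<times>\<^sub>s Z) (q, (y, z)) :: _ \<Rightarrow>\<^sub>0 'k)"
        using nd by (simp add: cls_def)
      also have "\<dots> = (\<Sum>Q\<in>cuts m q. smul (perm_sign m u Q * pos_sign m u Q)
          (tens (restrict_cls Y q y (?V Q 1)) (?D Q)))"
        by (rule AW_tilde_cls[OF XYZ(2,3) y z ob m_def])
      finally have "?A' (basis (q, (y, z))) = (\<Sum>Q\<in>cuts m q. smul (perm_sign m u Q * pos_sign m u Q)
          (tens (restrict_cls Y q y (?V Q 1)) (?D Q)))" .
      \<comment> \<open>The factor \<open>(- 1) ^ (k * p)\<close> is the Koszul sign of moving a map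
        of degree \<open>k\<close> past \<open>x\<close>.\<close>
      then have "?R (basis b) = (\<Sum>Q\<in>cuts m q. smul ((- 1) ^ (k * p) * (perm_sign m u Q * pos_sign m u Q))
          (tens (shuffle_map X Y (tens (basis (p, x)) (restrict_cls Y q y (?V Q 1)))) (?D Q)))"
        by (simp add: bs tensor_map_def[of fst k] lin_basis linear_map_smulD[OF ta]
            linear_map_smulD[OF linear_map_tensor_map] linear_map_sum[OF linear_map_tens_right]
            linear_map_sum[OF ta] linear_map_sum[OF linear_map_tensor_map] tensor_assoc_tens
            tensor_map_0_tens[OF linear_map_shuffle_map linear_map_id] smul_sum smul_simps(4)
            del: tens_list.simps)
      also have "\<dots> = (\<Sum>Q\<in>cuts m q. \<Sum>w\<in>words p (length (?V Q 1) - 1).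
        smul ((- 1) ^ (k * p) * (perm_sign m u Q * pos_sign m u Q) * (- 1) ^ inversions w)
          (tens (cls (X \<times>\<^sub>s Y) (p + (length (?V Q 1) - 1),
              (pull X p (walk True 0 w) x, pull Y (length (?V Q 1) - 1) (walk False 0 w) (pull Y q (?V Q 1) y))))
          (?D Q)))"
      proof (rule sum.cong[OF refl])
        fix Q assume Q: "Q \<in> cuts m q"
        have "?V Q 1 \<in> mon (length (?V Q 1) - 1) q"
          by (rule cut_vertices_mon(1)[OF Q]) (use one_biased_ex[OF ob, of 1] in \<open>simp add: m_def\<close>)
        \<comment> \<open>The restricted simplex may be degenerate, so
          \<open>shuffle_map_cls\<close> is used on its class.\<close>
        note y' = simplicial_set.pull_closed[OF XYZ(2) y this]
        show "smul ((- 1) ^ (k * p) * (perm_sign m u Q * pos_sign m u Q))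
            (tens (shuffle_map X Y (tens (basis (p, x)) (restrict_cls Y q y (?V Q 1)))) (?D Q))
          = (\<Sum>w\<in>words p (length (?V Q 1) - 1).
            smul ((- 1) ^ (k * p) * (perm_sign m u Q * pos_sign m u Q) * (- 1) ^ inversions w)
            (tens (cls (X \<times>\<^sub>s Y) (p + (length (?V Q 1) - 1),
                (pull X p (walk True 0 w) x, pull Y (length (?V Q 1) - 1) (walk False 0 w) (pull Y q (?V Q 1) y))))
            (?D Q)))"
          unfolding restrict_cls_def[of Y] shuffle_map_cls[OF XYZ(1,2) x y']
            linear_map_sum[OF linear_map_tens_left] smul_sum smul_simps(4) ..
      qed
      finally show ?thesis ..
    qed
    finally show "?L (basis b) = ?R (basis b)" .
  qed
  then show "(?A \<circ> chains_assoc X Y Z \<circ> shuffle_map X (Y \<times>\<^sub>s Z)) c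
      = (?T \<circ> tensor_assoc \<circ> tensor_map fst k id ?A') c"
    by (simp only: o_apply)
qed

end
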